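(* Let $0<\theta<1$ be given. Let $\tilde b=\tilde b(\mu,\sigma,\theta)$ be the scalar solving the equation $$E[b_\theta\wedge\tilde b]=b_0=1,$$ where $b_\theta$ denotes the random price at time $\theta$. Then the profit-optimizing level of advance purchase $u=u(\mu,\sigma,\theta)$ in the problem of maximizing $$E[f(z(b_\theta)+u)-b_\theta z(b_\theta)]-u$$ over scalars $u\ge 0$ and functions $z=z(b)\ge 0$ satisfies $$f'(u)=\tilde b,$$ and the optimal expected profit (the maximum value of this problem) is given by $$g(\mu,\sigma)=E[h(b_\theta)\mathbf 1_{\{b_\theta\le\tilde b\}}]+h(\tilde b)\cdot\Pr[b_\theta>\tilde b].$$
   Context: $f:[0,\infty)\to[0,\infty)$ is an Inada-type function: twice differentiable, increasing unboundedly from $f(0)=0$, with slope $f'$ unbounded at the origin and strictly decreasing to zero at infinity (so $f$ is strictly concave). The indirect profit at a deterministic price $b>0$ is $h(b)=\max_{x>0}[f(x)-bx]$. The price process $b_t$ satisfies $db_t/b_t=\bar\mu\,dt+\bar\sigma\,dw_t$, $b_0=1$, where $w_t$ is a standard Wiener process and $\bar\mu>0$, $\bar\sigma>0$ are constants. Write $\mu=\bar\mu\theta$ and $\sigma=\bar\sigma\sqrt\theta$; thus $\ln b_\theta$ is normal with mean $\mu-\tfrac12\sigma^2$ and variance $\sigma^2$, and $E[b_\theta]=e^{\mu}>1$. Here $x\wedge y=\min(x,y)$. The scalar $u$ is a quantity bought in advance (at time $0$) at unit price, and $z(b)$ is the non-negative supplementary quantity bought at time $\theta$ at the realized price $b=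b_\theta$.
   Formalization: If the maximum profit is infinite, which the assumptions on f allow, the optimal u is not unique; so f'(u) = b̃ is claimed for every optimal u only when the maximum is finite, and otherwise for some optimal u. *)

theory Defs
  imports "HOL-Probability.Probability"
begin

text \<open>Production functions live on \<open>[0,\<infinity>)\<close>. The slope is unbounded at the origin, so
  differentiability is required on \<open>(0,\<infinity>)\<close> and only continuity at \<open>0\<close>. Values of \<open>f\<close> at negative
  arguments are irrelevant.\<close>

definition inada :: "(real \<Rightarrow> real) \<Rightarrow> bool" where
  "inada f \<longleftrightarrow>
     f \<in> {0..} \<rightarrow> {0..} \<and> f 0 = 0 \<and> continuous_on {0..} f \<and>
     strict_mono_on {0..} f \<and> filterlim f at_top at_top \<and>
     (\<forall>x>0. f differentiable (at x)) \<and> (\<forall>x>0. deriv f differentiable (at x)) \<and>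
     filterlim (deriv f) at_top (at_right 0) \<and>
     strict_antimono_on {0<..} (deriv f) \<and>
     (deriv f \<longlongrightarrow> 0) at_top"

definition indirect_profit :: "(real \<Rightarrow> real) \<Rightarrow> real \<Rightarrow> real" where
  "indirect_profit f b = (GREATEST v. \<exists>x>0. v = f x - b * x)"

text \<open>A standard Wiener process relative to a filtration. Only times \<open>t \<ge> 0\<close> matter; a filtration
  indexed by \<open>[0,\<infinity>)\<close> is extended to negative indices by its initial \<open>\<sigma>\<close>-algebra.\<close>

definition wiener_process ::
  "'a measure \<Rightarrow> (real \<Rightarrow> 'a measure) \<Rightarrow> (real \<Rightarrow> 'a \<Rightarrow> real) \<Rightarrow> bool" where
  "wiener_process M F w \<longleftrightarrow>
     filtration (space M) F \<and> (\<forall>t. sets (F t) \<subseteq> sets M) \<and>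
     (\<forall>t\<ge>0. w t \<in> borel_measurable (F t)) \<and>
     (AE \<omega> in M. w 0 \<omega> = 0) \<and>
     (AE \<omega> in M. continuous_on {0..} (\<lambda>t. w t \<omega>)) \<and>
     (\<forall>s t. 0 \<le> s \<and> s < t \<longrightarrow>
        distributed M lborel (\<lambda>\<omega>. w t \<omega> - w s \<omega>) (normal_density 0 (sqrt (t - s))) \<and>
        prob_space.indep_set M (sets (F s))
          (sets (vimage_algebra (space M) (\<lambda>\<omega>. w t \<omega> - w s \<omega>) borel)))"

text \<open>\<open>I\<close> is a version of the It\^o integral of \<open>H\<close> with respect to \<open>X\<close> over \<open>[0,t]\<close>. For a
  continuous semimartingale \<open>X\<close> and a continuous adapted integrand \<open>H\<close>, it is the limit in
  probability of the left-endpoint sums over partitions \<open>0 = s\<^sub>0 \<le> \<dots> \<le> s\<^sub>n = t\<close> as the mesh tends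
  to \<open>0\<close>.\<close>

definition has_ito_integral ::
  "'a measure \<Rightarrow> (real \<Rightarrow> 'a \<Rightarrow> real) \<Rightarrow> (real \<Rightarrow> 'a \<Rightarrow> real) \<Rightarrow> real \<Rightarrow> ('a \<Rightarrow> real) \<Rightarrow> bool" where
  "has_ito_integral M H X t I \<longleftrightarrow>
     (\<forall>\<epsilon>>0. \<forall>\<delta>>0. \<exists>\<eta>>0. \<forall>(n::nat) (s::nat \<Rightarrow> real).
        s 0 = 0 \<and> s n = t \<and> (\<forall>i<n. s i \<le> s (Suc i) \<and> s (Suc i) - s i < \<eta>) \<longrightarrow>
        measure M {\<omega> \<in> space M.
          \<bar>(\<Sum>i<n. H (s i) \<omega> * (X (s (Suc i)) \<omega> - X (s i) \<omega>)) - I \<omega>\<bar> > \<epsilon>} < \<delta>)"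

text \<open>Positive continuous adapted solutions of \<open>db\<^sub>t / b\<^sub>t = \<mu> dt + \<sigma> dw\<^sub>t\<close> with \<open>b\<^sub>0 = 1\<close>. Since
  \<open>w\<^sub>0 = 0\<close>, the right-hand side integrates to \<open>\<mu> t + \<sigma> w\<^sub>t\<close>.\<close>

definition price_process ::
  "'a measure \<Rightarrow> (real \<Rightarrow> 'a measure) \<Rightarrow> (real \<Rightarrow> 'a \<Rightarrow> real) \<Rightarrow> real \<Rightarrow> real \<Rightarrow>
   (real \<Rightarrow> 'a \<Rightarrow> real) \<Rightarrow> bool" where
  "price_process M F w \<mu> \<sigma> b \<longleftrightarrow>
     (\<forall>t\<ge>0. b t \<in> borel_measurable (F t)) \<and>
     (AE \<omega> in M. b 0 \<omega> = 1) \<and>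
     (AE \<omega> in M. continuous_on {0..} (\<lambda>t. b t \<omega>)) \<and>
     (AE \<omega> in M. \<forall>t\<ge>0. b t \<omega> > 0) \<and>
     (\<forall>t\<ge>0. has_ito_integral M (\<lambda>s \<omega>. 1 / b s \<omega>) b t (\<lambda>\<omega>. \<mu> * t + \<sigma> * w t \<omega>))"

text \<open>The expected profit may be infinite: the Inada conditions do not force \<open>E[h(b\<^sub>\<theta>)]\<close> to be
  finite, because \<open>h\<close> can grow arbitrarily fast at \<open>0\<close>. Expectations of profits are therefore
  extended-real valued, and are used only where they are not of the form \<open>\<infinity> - \<infinity>\<close>.\<close>

definition expectation_exists :: "'a measure \<Rightarrow> ('a \<Rightarrow> real) \<Rightarrow> bool" where
  "expectation_exists M X \<longleftrightarrow>
     (\<integral>\<^sup>+\<omega>. ennreal (X \<omega>) \<partial>M) < \<infinity> \<or> (\<integral>\<^sup>+\<omega>. ennreal (- X \<omega>) \<partial>M) < \<infinity>"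

definition ext_expectation :: "'a measure \<Rightarrow> ('a \<Rightarrow> real) \<Rightarrow> ereal" where
  "ext_expectation M X =
     enn2ereal (\<integral>\<^sup>+\<omega>. ennreal (X \<omega>) \<partial>M) - enn2ereal (\<integral>\<^sup>+\<omega>. ennreal (- X \<omega>) \<partial>M)"

text \<open>In what follows \<open>B\<close> is the random price at the later date. A supplementary purchase rule is a
  function of the realized price; as \<open>B > 0\<close> almost surely, its values at nonpositive prices are
  immaterial.\<close>

definition profit :: "(real \<Rightarrow> real) \<Rightarrow> ('a \<Rightarrow> real) \<Rightarrow> real \<Rightarrow> (real \<Rightarrow> real) \<Rightarrow> 'a \<Rightarrow> real" where
  "profit f B u z = (\<lambda>\<omega>. f (z (B \<omega>) + u) - B \<omega> * z (B \<omega>))"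

definition admissible ::
  "'a measure \<Rightarrow> (real \<Rightarrow> real) \<Rightarrow> ('a \<Rightarrow> real) \<Rightarrow> real \<Rightarrow> (real \<Rightarrow> real) \<Rightarrow> bool" where
  "admissible M f B u z \<longleftrightarrow>
     u \<ge> 0 \<and> z \<in> borel_measurable borel \<and> (\<forall>b. z b \<ge> 0) \<and> expectation_exists M (profit f B u z)"

definition objective ::
  "'a measure \<Rightarrow> (real \<Rightarrow> real) \<Rightarrow> ('a \<Rightarrow> real) \<Rightarrow> real \<Rightarrow> (real \<Rightarrow> real) \<Rightarrow> ereal" where
  "objective M f B u z = ext_expectation M (profit f B u z) - ereal u"

definition optimal ::
  "'a measure \<Rightarrow> (real \<Rightarrow> real) \<Rightarrow> ('a \<Rightarrow> real) \<Rightarrow> real \<Rightarrow> (real \<Rightarrow> real) \<Rightarrow> bool" where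
  "optimal M f B u z \<longleftrightarrow>
     admissible M f B u z \<and>
     (\<forall>u' z'. admissible M f B u' z' \<longrightarrow> objective M f B u' z' \<le> objective M f B u z)"

text \<open>The claimed optimal value, for the threshold price \<open>c\<close>.\<close>

definition threshold_value :: "'a measure \<Rightarrow> (real \<Rightarrow> real) \<Rightarrow> ('a \<Rightarrow> real) \<Rightarrow> real \<Rightarrow> ereal" where
  "threshold_value M f B c =
     ext_expectation M (\<lambda>\<omega>. indirect_profit f (B \<omega>) * indicator {\<omega>. B \<omega> \<le> c} \<omega>) +
     ereal (indirect_profit f c * measure M {\<omega> \<in> space M. B \<omega> > c})"

end

theory Submission
  imports Defs
begin

text \<open>
  The economic part needs only three facts about the price \<open>B\<close> at the later date: it is almost surely
  positive, it is integrable, and \<open>E B > 1\<close>. The last one makes the threshold \<open>c\<close> with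
  \<open>E (min B c) = 1\<close> exist and be unique (\<open>ex1_threshold\<close>). Write \<open>h\<close> for the indirect profit.
  Treating \<open>min B c\<close> as the shadow price of input bounds the profit of every policy pointwise,
  \<open>f (z + u) - B z \<le> h (min B c) + min B c * u\<close>
  (\<open>profit_le_threshold_bound\<close>). In expectation the second term is \<open>u\<close>, which is exactly the
  cost of the advance purchase, so that no policy is worth more than \<open>E (h (min B c))\<close>, the claimed
  value. Buying \<open>u\<close> with \<open>f' u = c\<close> in advance, and topping up to the quantity demanded at the
  realized price if that is below \<open>c\<close>, attains the bound (\<open>optimal_threshold_policy\<close>). Conversely,
  if the value is finite, an optimal policy must attain the bound almost surely; as \<open>B > c\<close> has
  positive probability, this forces \<open>f' u = c\<close> (\<open>optimal_imp_demand\<close>).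

  The probabilistic part shows that the price is a geometric Brownian motion, directly from the Ito
  integral as a limit in probability of Riemann sums. Let \<open>L = ln b\<close>. The sums
  \<open>\<Sum> \<Delta>b / b = \<Sum> (exp \<Delta>L - 1)\<close> converge to \<open>\<mu> t + \<sigma> w t\<close>. Since \<open>exp x - 1 \<ge> x\<close>, the
  difference \<open>\<mu> t + \<sigma> w t - L t\<close> increases in \<open>t\<close> (\<open>log_price_increment_le\<close>). Therefore \<open>L\<close> is
  \<open>\<sigma> w\<close> plus a continuous path of bounded variation and has the quadratic variation \<open>\<sigma>\<^sup>2 t\<close>
  of \<open>\<sigma> w\<close>. The second-order expansion of \<open>exp\<close> then identifies the difference as
  \<open>\<sigma>\<^sup>2 t / 2\<close> (\<open>log_price_pathwise\<close>,
  \<open>price_process_eq_geometric_brownian_motion\<close>). The Gaussian exponential moment yields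
  \<open>E B = exp (\<mu> \<theta>) > 1\<close> (\<open>expectation_price\<close>).
\<close>

section \<open>Input demand and indirect profit\<close>

lemma inada_deriv_less_iff:
  assumes "inada f" "x > 0" "y > 0"
  shows "deriv f x < deriv f y \<longleftrightarrow> y < x"
proof -
  have dec: "u > 0 \<Longrightarrow> u < v \<Longrightarrow> deriv f v < deriv f u" for u v
    using assms(1) unfolding inada_def monotone_on_def by auto
  show ?thesis
    using dec[of x y] dec[of y x] assms by (cases x y rule: linorder_cases) auto
qed

lemma inada_deriv_surj:
  assumes f: "inada f" and p: "p > 0"
  shows "\<exists>x>0. deriv f x = p"
proof -
  have "eventually (\<lambda>x. x > 0 \<and> deriv f x > p) (at_right 0)"
    using f unfolding inada_def
    by (intro eventually_conj)
       (auto simp: eventually_at_right_less filterlim_at_top_dense)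
  then obtain x where x: "x > 0" "deriv f x > p"
    using eventually_happens'[of "at_right (0::real)"] by auto
  have "eventually (\<lambda>y. y > 0 \<and> deriv f y < p) at_top"
    using f p unfolding inada_def
    by (intro eventually_conj eventually_gt_at_top order_tendstoD) auto
  then obtain y where y: "y > 0" "deriv f y < p"
    using eventually_happens'[of "at_top :: real filter"] by auto
  have "x < y" using inada_deriv_less_iff[OF f y(1) x(1)] x y by simp
  moreover have "isCont (deriv f) t" if "t > 0" for t
    using f that unfolding inada_def
    by (intro differentiable_imp_continuous_within) auto
  ultimately obtain t where "x \<le> t" "t \<le> y" "deriv f t = p"
    using IVT2[of "deriv f" y p x] x y by force
  with x show ?thesis by (intro exI[of _ t]) auto
qed

text \<open>On positive prices this is the inverse of the marginal product \<open>deriv f\<close>. At other prices it is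
  unspecified, and every later use guards against them.\<close>

definition demand :: "(real \<Rightarrow> real) \<Rightarrow> real \<Rightarrow> real" where
  "demand f p = (THE x. x > 0 \<and> deriv f x = p)"

lemma
  assumes "inada f" "p > 0"
  shows demand_pos: "demand f p > 0" and deriv_demand: "deriv f (demand f p) = p"
proof -
  have "\<exists>!x. x > 0 \<and> deriv f x = p"
    using inada_deriv_surj[OF assms] inada_deriv_less_iff[OF assms(1)]
    by (metis less_irrefl linorder_neqE)
  from theI'[OF this] show "demand f p > 0" "deriv f (demand f p) = p"
    unfolding demand_def by auto
qed

lemma demand_antimono:
  assumes "inada f" "0 < p" "p \<le> q"
  shows "demand f q \<le> demand f p"
  using inada_deriv_less_iff[OF assms(1), of "demand f q" "demand f p"]
    demand_pos[OF assms(1)] deriv_demand[OF assms(1)] assms by force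

lemma demand_measurable:
  assumes "inada f"
  shows "(\<lambda>p. if p > 0 then demand f p else 0) \<in> borel_measurable borel"
proof -
  have "mono_on {0<..} (\<lambda>p. - demand f p)"
    using demand_antimono[OF assms] by (auto intro!: mono_onI)
  from borel_measurable_mono_on_fnc[OF this]
  have "demand f \<in> borel_measurable (restrict_space borel {0<..})"
    using borel_measurable_uminus by fastforce
  then show ?thesis
    by (subst (asm) measurable_restrict_space_iff[where c = 0]) auto
qed

text \<open>The slope of \<open>x \<mapsto> f x - p * x\<close> is \<open>deriv f x - p\<close>, which changes sign from positive to negative
  at \<open>demand f p\<close>, so the mean value theorem gives a strict global maximum. The boundary point
  \<open>x = 0\<close> is covered as well, because the mean value theorem needs differentiability only in the
  interior; it is this that rules out buying nothing.\<close>

lemma profit_lt_demand_profit: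
  assumes f: "inada f" and p: "p > 0" and x: "x \<ge> 0" "x \<noteq> demand f p"
  shows "f x - p * x < f (demand f p) - p * demand f p"
proof -
  let ?a = "demand f p"
  note a = demand_pos[OF f p] deriv_demand[OF f p]
  have cont: "continuous_on {s..t} f" if "s \<ge> 0" for s t
    using f that unfolding inada_def by (auto intro: continuous_on_subset)
  have diff: "f differentiable (at t)" if "t > 0" for t
    using f that unfolding inada_def by auto
  consider "x < ?a" | "?a < x" using x by linarith
  then show ?thesis
  proof cases
    case 1
    obtain l t where t: "x < t" "t < ?a" "(f has_real_derivative l) (at t)"
        "f ?a - f x = (?a - x) * l"
      using MVT[of x ?a f] 1 cont[of x] diff x by auto
    have "l = deriv f t" using t(3) by (simp add: DERIV_imp_deriv)
    then have "l > p"
      using inada_deriv_less_iff[OF f, of ?a t] a t x by auto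
    then have "(?a - x) * l > (?a - x) * p" using 1 by simp
    with t(4) show ?thesis by (simp add: algebra_simps)
  next
    case 2
    obtain l t where t: "?a < t" "t < x" "(f has_real_derivative l) (at t)"
        "f x - f ?a = (x - ?a) * l"
      using MVT[of ?a x f] 2 cont[of ?a] diff a by auto
    have "l = deriv f t" using t(3) by (simp add: DERIV_imp_deriv)
    then have "l < p"
      using inada_deriv_less_iff[OF f, of t ?a] a t x by auto
    then have "(x - ?a) * l < (x - ?a) * p" using 2 by simp
    with t(4) show ?thesis by (simp add: algebra_simps)
  qed
qed

lemma indirect_profit_eq:
  assumes "inada f" "p > 0"
  shows "indirect_profit f p = f (demand f p) - p * demand f p"
  unfolding indirect_profit_def
proof (rule Greatest_equality)
  show "\<exists>x>0. f (demand f p) - p * demand f p = f x - p * x"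
    using demand_pos[OF assms] by blast
next
  fix v assume "\<exists>x>0. v = f x - p * x"
  then show "v \<le> f (demand f p) - p * demand f p"
    using profit_lt_demand_profit[OF assms] by (metis order_le_less less_imp_le)
qed

lemma profit_le_indirect_profit:
  assumes "inada f" "p > 0" "x \<ge> 0"
  shows "f x - p * x \<le> indirect_profit f p"
  using profit_lt_demand_profit[OF assms] indirect_profit_eq[OF assms(1,2)] 
  by (cases "x = demand f p") auto

lemma profit_eq_indirect_profit_iff:
  assumes "inada f" "p > 0" "x \<ge> 0"
  shows "f x - p * x = indirect_profit f p \<longleftrightarrow> x = demand f p"
  using profit_lt_demand_profit[OF assms] indirect_profit_eq[OF assms(1,2)]
  by (cases "x = demand f p") auto

lemma indirect_profit_nonneg: "inada f \<Longrightarrow> p > 0 \<Longrightarrow> indirect_profit f p \<ge> 0"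
  using profit_le_indirect_profit[of f p 0] by (simp add: inada_def)

text \<open>Nothing is known about \<open>f\<close> at negative arguments; the truncation makes it continuous on the whole
  line without changing it at the quantities that are actually bought.\<close>

lemma inada_measurable:
  assumes "inada f"
  shows "(\<lambda>x. f (max 0 x)) \<in> borel_measurable borel"
proof -
  have "continuous_on UNIV (f \<circ> (\<lambda>x. max 0 x))"
    using assms unfolding inada_def
    by (intro continuous_on_compose continuous_intros) (auto intro: continuous_on_subset)
  then show ?thesis by (simp add: o_def borel_measurable_continuous_onI)
qed

text \<open>A supremum over uncountably many quantities has no reason to be measurable; the explicit
  maximizer \<open>demand\<close> is antitone, hence Borel, and transfers its measurability.\<close>

lemma indirect_profit_measurable:
  assumes "inada f"
  shows "(\<lambda>p. if p > 0 then indirect_profit f p else 0) \<in> borel_measurable borel"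
proof -
  define x where "x p = (if p > 0 then demand f p else 0)" for p
  have [measurable]: "x \<in> borel_measurable borel"
    unfolding x_def by (rule demand_measurable[OF assms])
  note [measurable] = inada_measurable[OF assms]
  have "(\<lambda>p. f (max 0 (x p)) - p * x p) \<in> borel_measurable borel"
    by measurable
  moreover have "(\<lambda>p. f (max 0 (x p)) - p * x p) = (\<lambda>p. if p > 0 then indirect_profit f p else 0)"
    using assms by (auto simp: x_def indirect_profit_eq max_def not_le demand_pos less_imp_le inada_def)
  ultimately show ?thesis by simp
qed

section \<open>Extended-real expectations\<close>

lemma ext_expectation_mono:
  assumes "AE \<omega> in M. X \<omega> \<le> Y \<omega>"
  shows "ext_expectation M X \<le> ext_expectation M Y"
  unfolding ext_expectation_def
proof (rule ereal_minus_mono)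
  show "enn2ereal (\<integral>\<^sup>+ \<omega>. ennreal (X \<omega>) \<partial>M) \<le> enn2ereal (\<integral>\<^sup>+ \<omega>. ennreal (Y \<omega>) \<partial>M)"
    unfolding less_eq_ennreal.rep_eq[symmetric]
    by (rule nn_integral_mono_AE) (use assms in \<open>auto intro: ennreal_leI\<close>)
  show "enn2ereal (\<integral>\<^sup>+ \<omega>. ennreal (- Y \<omega>) \<partial>M) \<le> enn2ereal (\<integral>\<^sup>+ \<omega>. ennreal (- X \<omega>) \<partial>M)"
    unfolding less_eq_ennreal.rep_eq[symmetric]
    by (rule nn_integral_mono_AE) (use assms in \<open>eventually_elim, auto intro: ennreal_leI\<close>)
qed

lemma ext_expectation_cong:
  assumes "AE \<omega> in M. X \<omega> = Y \<omega>"
  shows "ext_expectation M X = ext_expectation M Y"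
  by (rule antisym; rule ext_expectation_mono) (use assms in auto)

lemma nn_integral_uminus_nonneg:
  fixes X :: "'a \<Rightarrow> real"
  assumes "AE \<omega> in M. X \<omega> \<ge> 0"
  shows "(\<integral>\<^sup>+ \<omega>. ennreal (- X \<omega>) \<partial>M) = 0"
proof -
  have "(\<integral>\<^sup>+ \<omega>. ennreal (- X \<omega>) \<partial>M) = (\<integral>\<^sup>+ \<omega>. 0 \<partial>M)"
    by (rule nn_integral_cong_AE) (use assms in \<open>auto simp: ennreal_neg\<close>)
  then show ?thesis by simp
qed

lemma ext_expectation_nonneg:
  assumes "AE \<omega> in M. X \<omega> \<ge> 0"
  shows "ext_expectation M X = enn2ereal (\<integral>\<^sup>+ \<omega>. ennreal (X \<omega>) \<partial>M)"
  by (simp add: ext_expectation_def nn_integral_uminus_nonneg[OF assms] zero_ennreal.rep_eq)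

text \<open>Used with \<open>X\<close> the indirect profit, whose expectation may be infinite, and \<open>Z\<close> the value
  \<open>min B c * u\<close> of the advance purchase, whose expectation is finite.\<close>

lemma ext_expectation_add_integrable:
  assumes X [measurable]: "X \<in> borel_measurable M" and X0: "AE \<omega> in M. X \<omega> \<ge> 0"
    and Z: "integrable M Z" and Z0: "AE \<omega> in M. Z \<omega> \<ge> 0"
  shows "ext_expectation M (\<lambda>\<omega>. X \<omega> + Z \<omega>) = ext_expectation M X + ereal (integral\<^sup>L M Z)"
proof -
  have [measurable]: "Z \<in> borel_measurable M" using Z by simp
  have "(\<integral>\<^sup>+ \<omega>. ennreal (X \<omega> + Z \<omega>) \<partial>M) = (\<integral>\<^sup>+ \<omega>. ennreal (X \<omega>) + ennreal (Z \<omega>) \<partial>M)"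
    by (rule nn_integral_cong_AE) (use X0 Z0 in \<open>eventually_elim; simp\<close>)
  also have "\<dots> = (\<integral>\<^sup>+ \<omega>. ennreal (X \<omega>) \<partial>M) + ennreal (integral\<^sup>L M Z)"
    by (subst nn_integral_add) (auto simp: nn_integral_eq_integral[OF Z Z0])
  finally have *: "enn2ereal (\<integral>\<^sup>+ \<omega>. ennreal (X \<omega> + Z \<omega>) \<partial>M)
      = enn2ereal (\<integral>\<^sup>+ \<omega>. ennreal (X \<omega>) \<partial>M) + ereal (integral\<^sup>L M Z)"
    by (simp add: plus_ennreal.rep_eq enn2ereal_ennreal integral_nonneg_AE[OF Z0])
  have "AE \<omega> in M. X \<omega> + Z \<omega> \<ge> 0" using X0 Z0 by eventually_elim simp
  with * show ?thesis by (simp add: ext_expectation_nonneg X0)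
qed

text \<open>The equality case of monotonicity. Finiteness of the larger expectation is essential: from
  \<open>\<infinity> = \<infinity>\<close> nothing follows, which is why uniqueness of the optimal advance purchase is
  claimed only for a finite optimal value.\<close>

lemma ext_expectation_eq_imp_AE_eq:
  assumes X [measurable]: "X \<in> borel_measurable M" and Y [measurable]: "Y \<in> borel_measurable M"
    and XY: "AE \<omega> in M. X \<omega> \<le> Y \<omega>" and Y0: "AE \<omega> in M. Y \<omega> \<ge> 0"
    and fin: "ext_expectation M Y < \<infinity>" and ge: "ext_expectation M Y \<le> ext_expectation M X"
  shows "AE \<omega> in M. X \<omega> = Y \<omega>"
proof -
  let ?y = "\<integral>\<^sup>+ \<omega>. ennreal (Y \<omega>) \<partial>M" and ?x = "\<integral>\<^sup>+ \<omega>. ennreal (X \<omega>) \<partial>M"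
    and ?n = "\<integral>\<^sup>+ \<omega>. ennreal (- X \<omega>) \<partial>M"
  have xy: "?x \<le> ?y"
    by (rule nn_integral_mono_AE) (use XY in \<open>auto intro: ennreal_leI\<close>)
  have y: "?y < \<infinity>"
    using fin unfolding ext_expectation_nonneg[OF Y0]
    by (metis ennreal.rep_eq enn2ereal_ennreal infinity_ennreal_def less_ennreal.rep_eq top_ereal_def
      enn2ereal_top)
  have Yint: "integrable M Y"
    by (rule integrableI_nonneg) (use Y0 y in auto)
  have "enn2ereal ?y \<le> enn2ereal ?x - enn2ereal ?n"
    using ge unfolding ext_expectation_nonneg[OF Y0] by (simp add: ext_expectation_def)
  moreover have "enn2ereal ?x \<le> enn2ereal ?y" using xy by (simp add: less_eq_ennreal.rep_eq)
  moreover have "enn2ereal ?n \<ge> 0" "enn2ereal ?x \<ge> 0" by simp_all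
  moreover have "enn2ereal ?y < \<infinity>" using fin unfolding ext_expectation_nonneg[OF Y0] .
  \<comment> \<open>With \<open>y\<close> finite, \<open>y \<le> x - n\<close> and \<open>0 \<le> x \<le> y\<close> leave no room for a negative part.\<close>
  ultimately have n: "enn2ereal ?n = 0" and x: "enn2ereal ?x = enn2ereal ?y"
    by (cases "enn2ereal ?n"; cases "enn2ereal ?x"; cases "enn2ereal ?y"; simp)+
  have "?n = 0" using n by (metis zero_ennreal.rep_eq enn2ereal_inject)
  then have X0: "AE \<omega> in M. X \<omega> \<ge> 0"
    by (subst (asm) nn_integral_0_iff_AE) (auto simp: ennreal_eq_0_iff)
  have Xint: "integrable M X"
    by (rule Bochner_Integration.integrable_bound[OF Yint])
       (use X0 XY Y0 in \<open>measurable, eventually_elim, auto\<close>)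
  have "?x = ?y" using x by (simp add: enn2ereal_inject)
  then have "integral\<^sup>L M X = integral\<^sup>L M Y"
    using X0 Y0 by (simp add: integral_eq_nn_integral)
  then have "(\<integral>\<omega>. Y \<omega> - X \<omega> \<partial>M) = 0" using Xint Yint by simp
  moreover have "AE \<omega> in M. Y \<omega> - X \<omega> \<ge> 0" using XY by eventually_elim simp
  ultimately have "AE \<omega> in M. Y \<omega> - X \<omega> = 0"
    using integral_nonneg_eq_0_iff_AE[of M "\<lambda>\<omega>. Y \<omega> - X \<omega>"] Xint Yint by simp
  then show ?thesis by eventually_elim simp
qed

section \<open>Optimal advance purchase\<close>

text \<open>The heart of the optimization is duality, with the shadow price \<open>p = min B c\<close> of input. Buying
  everything at price \<open>p\<close> earns at most \<open>h p\<close>; the input \<open>u\<close> already in stock is worth \<open>p * u\<close>;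
  and supplementary input actually costs \<open>B \<ge> p\<close>. The bound is linear in \<open>u\<close>, and the choice of
  \<open>c\<close> makes its mean slope \<open>E p = 1\<close> equal to the unit price of advance purchase.\<close>

lemma profit_le_threshold_bound:
  assumes f: "inada f" and B: "B \<omega> > 0" and c: "c > 0" and uz: "u \<ge> 0" "\<forall>b. z b \<ge> 0"
  shows "profit f B u z \<omega> \<le> indirect_profit f (min (B \<omega>) c) + min (B \<omega>) c * u"
proof -
  let ?p = "min (B \<omega>) c"
  have "f (z (B \<omega>) + u) - ?p * (z (B \<omega>) + u) \<le> indirect_profit f ?p"
    using assms by (intro profit_le_indirect_profit) auto
  moreover have "?p * z (B \<omega>) \<le> B \<omega> * z (B \<omega>)"
    using uz by (intro mult_right_mono) auto
  ultimately show ?thesis by (simp add: profit_def algebra_simps)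
qed

context prob_space
begin

text \<open>The map \<open>c \<mapsto> E (min B c)\<close> is 1-Lipschitz, is at most \<open>1\<close> at \<open>c = 0\<close>, and tends to
  \<open>E B > 1\<close>, so the intermediate value theorem applies. If it took the value \<open>1\<close> twice, at
  \<open>c < d\<close>, then \<open>B\<close> could not exceed \<open>c\<close>, and \<open>E B\<close> would be \<open>1\<close>.\<close>

lemma ex1_threshold:
  fixes B :: "'a \<Rightarrow> real"
  assumes B: "integrable M B" and B0: "AE \<omega> in M. B \<omega> > 0" and B1: "expectation B > 1"
  shows "\<exists>!c. expectation (\<lambda>\<omega>. min (B \<omega>) c) = 1"
proof -
  let ?m = "\<lambda>c. expectation (\<lambda>\<omega>. min (B \<omega>) c)"
  note [simp] = B
  have [measurable]: "B \<in> borel_measurable M" by (rule borel_measurable_integrable[OF B])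
  have int [simp]: "integrable M (\<lambda>\<omega>. min (B \<omega>) c)" for c by (rule Bochner_Integration.integrable_min) auto
  have "continuous_on {0..real n} ?m" for n
  proof (rule continuous_on_subset[of UNIV])
    show "continuous_on UNIV ?m"
    proof (intro continuous_at_imp_continuous_on ballI)
      fix c show "isCont ?m c"
        unfolding isCont_def
      proof (rule tendsto_dist_iff[THEN iffD2], rule tendsto_sandwich[of "\<lambda>_. 0" _ _ "\<lambda>d. dist d c"])
        show "eventually (\<lambda>d. dist (?m d) (?m c) \<le> dist d c) (at c)"
        proof (rule always_eventually, rule allI)
          fix d
          have "dist (?m d) (?m c) = \<bar>expectation (\<lambda>\<omega>. min (B \<omega>) d - min (B \<omega>) c)\<bar>"
            by (simp add: dist_real_def)
          also have "\<dots> \<le> expectation (\<lambda>\<omega>. \<bar>min (B \<omega>) d - min (B \<omega>) c\<bar>)"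
            by (rule integral_abs_bound)
          also have "\<dots> \<le> expectation (\<lambda>\<omega>. \<bar>d - c\<bar>)"
            by (intro integral_mono integrable_abs Bochner_Integration.integrable_diff int) auto
          finally show "dist (?m d) (?m c) \<le> dist d c" by (simp add: dist_real_def prob_space)
        qed
        show "((\<lambda>d. dist d c) \<longlongrightarrow> 0) (at c)"
          using tendsto_dist[OF tendsto_ident_at[of c UNIV] tendsto_const[of c]] by simp
      qed auto
    qed
  qed auto
  moreover have "\<exists>n. ?m (real n) > 1"
  proof -
    have "(\<lambda>n. ?m (real n)) \<longlonglongrightarrow> expectation B"
    proof (rule integral_dominated_convergence[where w = "\<lambda>\<omega>. \<bar>B \<omega>\<bar>"])
      show "AE \<omega> in M. (\<lambda>n. min (B \<omega>) (real n)) \<longlonglongrightarrow> B \<omega>"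
      proof (rule AE_I2, rule tendsto_eventually)
        fix \<omega> 
        show "eventually (\<lambda>n. min (B \<omega>) (real n) = B \<omega>) sequentially"
          using eventually_ge_at_top[of "nat \<lceil>B \<omega>\<rceil>"] by eventually_elim linarith
      qed
      show "AE \<omega> in M. norm (min (B \<omega>) (real n)) \<le> \<bar>B \<omega>\<bar>" for n
        using B0 by eventually_elim auto
    qed (simp_all, measurable)
    from order_tendstoD(1)[OF this B1] show ?thesis
      using eventually_happens' sequentially_bot by blast
  qed
  then obtain n where "?m (real n) > 1" by blast
  moreover have "?m 0 \<le> 1" 
    using integral_mono[of M "\<lambda>\<omega>. min (B \<omega>) 0" "\<lambda>_. 1"] by (auto simp: prob_space)
  ultimately obtain c where "?m c = 1"
    using IVT'[of ?m 0 1 "real n"] by auto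
  moreover have "c = d" if "?m c = 1" "?m d = 1" for c d
  proof -
    have "\<not> c < d" if "?m c = 1" "?m d = 1" for c d
    proof
      assume "c < d"
      have "AE \<omega> in M. min (B \<omega>) d - min (B \<omega>) c = 0"
        using integral_nonneg_eq_0_iff_AE[of M "\<lambda>\<omega>. min (B \<omega>) d - min (B \<omega>) c"] that \<open>c < d\<close> by auto
      then have "AE \<omega> in M. B \<omega> = min (B \<omega>) c"
        by eventually_elim (use \<open>c < d\<close> in \<open>auto simp: min_def split: if_splits\<close>)
      then have "expectation B = ?m c" by (intro integral_cong_AE) auto
      with B1 that show False by simp
    qed
    from this[of c d] this[of d c] that show ?thesis by auto
  qed
  ultimately show ?thesis by blast
qed

text \<open>The two terms of the claimed value are the parts of \<open>E (h (min B c))\<close> over \<open>B \<le> c\<close> and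
  \<open>B > c\<close>. In this form the value fits the bound of \<open>profit_le_threshold_bound\<close>.\<close>

lemma threshold_value_eq:
  assumes f: "inada f" and B [measurable]: "B \<in> borel_measurable M"
    and B0: "AE \<omega> in M. B \<omega> > 0" and c: "c > 0"
  shows "threshold_value M f B c = ext_expectation M (\<lambda>\<omega>. indirect_profit f (min (B \<omega>) c))"
proof -
  \<comment> \<open>\<open>H\<close> is a Borel version of the indirect profit, agreeing with it almost surely.\<close>
  define H where "H = (\<lambda>p. if p > 0 then indirect_profit f p else 0)"
  have [measurable]: "H \<in> borel_measurable borel"
    unfolding H_def by (rule indirect_profit_measurable[OF f])
  have H0: "H p \<ge> 0" for p using indirect_profit_nonneg[OF f] by (simp add: H_def)
  have "ext_expectation M (\<lambda>\<omega>. indirect_profit f (min (B \<omega>) c)) =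
      ext_expectation M (\<lambda>\<omega>. H (B \<omega>) * indicator {\<omega>\<in>space M. B \<omega> \<le> c} \<omega> + H c * indicator {\<omega>\<in>space M. B \<omega> > c} \<omega>)"
  proof (rule ext_expectation_cong)
    show "AE \<omega> in M. indirect_profit f (min (B \<omega>) c) =
        H (B \<omega>) * indicator {\<omega>\<in>space M. B \<omega> \<le> c} \<omega> + H c * indicator {\<omega>\<in>space M. B \<omega> > c} \<omega>"
      using B0 AE_space
      by eventually_elim (use c in \<open>auto simp: H_def min_def indicator_def\<close>)
  qed
  also have "\<dots> = ext_expectation M (\<lambda>\<omega>. H (B \<omega>) * indicator {\<omega>\<in>space M. B \<omega> \<le> c} \<omega>) +
      ereal (H c * measure M {\<omega>\<in>space M. B \<omega> > c})"
    using H0 by (subst ext_expectation_add_integrable) (auto intro!: integrable_real_indicator simp: less_top[symmetric])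
  also have "ext_expectation M (\<lambda>\<omega>. H (B \<omega>) * indicator {\<omega>\<in>space M. B \<omega> \<le> c} \<omega>) =
      ext_expectation M (\<lambda>\<omega>. indirect_profit f (B \<omega>) * indicator {\<omega>. B \<omega> \<le> c} \<omega>)"
  proof (rule ext_expectation_cong)
    show "AE \<omega> in M. H (B \<omega>) * indicator {\<omega>\<in>space M. B \<omega> \<le> c} \<omega> =
        indirect_profit f (B \<omega>) * indicator {\<omega>. B \<omega> \<le> c} \<omega>"
      using B0 AE_space by eventually_elim (auto simp: H_def indicator_def)
  qed
  finally show ?thesis using c by (simp add: threshold_value_def H_def)
qed

lemma ext_expectation_threshold_bound:
  assumes f: "inada f" and B [measurable]: "B \<in> borel_measurable M"
    and B0: "AE \<omega> in M. B \<omega> > 0" and c: "c > 0"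
    and int: "integrable M B" and Ec: "expectation (\<lambda>\<omega>. min (B \<omega>) c) = 1" and u: "u \<ge> 0"
  shows "ext_expectation M (\<lambda>\<omega>. indirect_profit f (min (B \<omega>) c) + min (B \<omega>) c * u) =
    threshold_value M f B c + ereal u"
proof -
  define H where "H = (\<lambda>p. if p > 0 then indirect_profit f p else 0)"
  have [measurable]: "H \<in> borel_measurable borel"
    unfolding H_def by (rule indirect_profit_measurable[OF f])
  have H0: "H p \<ge> 0" for p using indirect_profit_nonneg[OF f] by (simp add: H_def)
  have HB: "AE \<omega> in M. H (min (B \<omega>) c) = indirect_profit f (min (B \<omega>) c)"
    using B0 by eventually_elim (use c in \<open>auto simp: H_def\<close>)
  have "ext_expectation M (\<lambda>\<omega>. indirect_profit f (min (B \<omega>) c) + min (B \<omega>) c * u) =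
      ext_expectation M (\<lambda>\<omega>. H (min (B \<omega>) c) + min (B \<omega>) c * u)"
    by (rule ext_expectation_cong) (use HB in \<open>eventually_elim, simp\<close>)
  also have "\<dots> = ext_expectation M (\<lambda>\<omega>. H (min (B \<omega>) c)) + ereal (expectation (\<lambda>\<omega>. min (B \<omega>) c * u))"
    using H0 B0 int u c
    by (intro ext_expectation_add_integrable) (auto elim!: eventually_mono)
  also have "ext_expectation M (\<lambda>\<omega>. H (min (B \<omega>) c)) = threshold_value M f B c"
    unfolding threshold_value_eq[OF f B B0 c] using HB by (rule ext_expectation_cong)
  finally show ?thesis using Ec by simp
qed

lemma threshold_value_nonneg:
  assumes f: "inada f" and B: "B \<in> borel_measurable M"
    and B0: "AE \<omega> in M. B \<omega> > 0" and c: "c > 0"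
  shows "threshold_value M f B c \<ge> 0"
proof -
  have "AE \<omega> in M. indirect_profit f (min (B \<omega>) c) \<ge> 0"
    using B0 by eventually_elim (use c indirect_profit_nonneg[OF f] in auto)
  then show ?thesis unfolding threshold_value_eq[OF assms] by (simp add: ext_expectation_nonneg)
qed

lemma objective_le_threshold_value:
  assumes f: "inada f" and B: "B \<in> borel_measurable M"
    and B0: "AE \<omega> in M. B \<omega> > 0" and c: "c > 0"
    and int: "integrable M B" and Ec: "expectation (\<lambda>\<omega>. min (B \<omega>) c) = 1"
    and adm: "admissible M f B u z"
  shows "objective M f B u z \<le> threshold_value M f B c"
proof -
  have uz: "u \<ge> 0" "\<forall>b. z b \<ge> 0" using adm by (auto simp: admissible_def)
  have "ext_expectation M (profit f B u z) \<le>
      ext_expectation M (\<lambda>\<omega>. indirect_profit f (min (B \<omega>) c) + min (B \<omega>) c * u)"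
  proof (rule ext_expectation_mono)
    show "AE \<omega> in M. profit f B u z \<omega> \<le> indirect_profit f (min (B \<omega>) c) + min (B \<omega>) c * u"
      using B0 by eventually_elim (rule profit_le_threshold_bound[OF f _ c uz])
  qed
  also have "\<dots> = threshold_value M f B c + ereal u"
    by (rule ext_expectation_threshold_bound) fact+
  finally show ?thesis
    unfolding objective_def by (simp add: ereal_minus_le)
qed

text \<open>Holding \<open>demand f c\<close> in advance and topping up to \<open>demand f B\<close> when the price falls below \<open>c\<close>
  makes both inequalities behind \<open>profit_le_threshold_bound\<close> equalities: total input is
  \<open>demand f (min B c)\<close>, and supplementary input is bought only where \<open>B\<close> equals the shadow price.\<close>

lemma optimal_threshold_policy:
  assumes f: "inada f" and B: "B \<in> borel_measurable M"
    and B0: "AE \<omega> in M. B \<omega> > 0" and c: "c > 0"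
    and int: "integrable M B" and Ec: "expectation (\<lambda>\<omega>. min (B \<omega>) c) = 1"
  defines "u \<equiv> demand f c"
  defines "z \<equiv> (\<lambda>b. max 0 ((if b > 0 then demand f b else 0) - u))"
  shows "optimal M f B u z" and "objective M f B u z = threshold_value M f B c"
proof -
  have u: "u > 0" using demand_pos[OF f c] by (simp add: u_def)
  have z [measurable]: "z \<in> borel_measurable borel"
    unfolding z_def using demand_measurable[OF f] by measurable
  have z0: "\<forall>b. z b \<ge> 0" by (simp add: z_def)
  have eq: "AE \<omega> in M. profit f B u z \<omega> = indirect_profit f (min (B \<omega>) c) + min (B \<omega>) c * u"
    using B0
  proof eventually_elim
    case (elim \<omega>)
    show ?case
    proof (cases "B \<omega> \<le> c")
      case True
      then have "z (B \<omega>) + u = demand f (B \<omega>)"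
        using demand_antimono[OF f elim True] elim by (simp add: z_def u_def)
      then show ?thesis
        using True elim f by (simp add: profit_def indirect_profit_eq algebra_simps flip: \<open>_ = demand f (B \<omega>)\<close>)
    next
      case False
      then have "z (B \<omega>) = 0"
        using demand_antimono[OF f c, of "B \<omega>"] elim by (simp add: z_def u_def)
      then show ?thesis
        using False c f by (simp add: profit_def indirect_profit_eq algebra_simps u_def)
    qed
  qed
  have pos: "AE \<omega> in M. profit f B u z \<omega> \<ge> 0"
    using eq B0 by eventually_elim (use c u indirect_profit_nonneg[OF f] in auto)
  have adm: "admissible M f B u z"
    using u z z0 pos by (simp add: admissible_def expectation_exists_def nn_integral_uminus_nonneg)
  have "ext_expectation M (profit f B u z) = threshold_value M f B c + ereal u"
    using ext_expectation_cong[OF eq] ext_expectation_threshold_bound[OF f B B0 c int Ec] u by simp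
  then show obj: "objective M f B u z = threshold_value M f B c"
    unfolding objective_def using threshold_value_nonneg[OF f B B0 c]
    by (cases "threshold_value M f B c") auto
  show "optimal M f B u z"
    unfolding optimal_def obj using adm objective_le_threshold_value[OF f B B0 c int Ec] by blast
qed

text \<open>An optimal policy attains the pointwise bound almost surely when the value is finite. The event
  \<open>B > c\<close> has positive probability, since otherwise \<open>E B = E (min B c) = 1\<close>. On it
  nothing is bought later, so \<open>u\<close> alone maximizes profit at the price \<open>c\<close>.\<close>

lemma optimal_imp_demand:
  assumes f: "inada f" and B [measurable]: "B \<in> borel_measurable M"
    and B0: "AE \<omega> in M. B \<omega> > 0" and c: "c > 0"
    and int: "integrable M B" and Ec: "expectation (\<lambda>\<omega>. min (B \<omega>) c) = 1" 
    and EB: "expectation B > 1"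
    and adm: "admissible M f B u z" and obj: "objective M f B u z = threshold_value M f B c"
    and fin: "threshold_value M f B c < \<infinity>"
  shows "u = demand f c"
proof -
  have uz: "u \<ge> 0" "\<forall>b. z b \<ge> 0" and [measurable]: "z \<in> borel_measurable borel"
    using adm by (auto simp: admissible_def)
  note [measurable] = inada_measurable[OF f]
  define H where "H = (\<lambda>p. if p > 0 then indirect_profit f p else 0)"
  have [measurable]: "H \<in> borel_measurable borel"
    unfolding H_def by (rule indirect_profit_measurable[OF f])
  define Y where "Y = (\<lambda>\<omega>. H (min (B \<omega>) c) + min (B \<omega>) c * u)"
  have [measurable]: "Y \<in> borel_measurable M" unfolding Y_def by measurable
  have Y: "AE \<omega> in M. Y \<omega> = indirect_profit f (min (B \<omega>) c) + min (B \<omega>) c * u"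
    using B0 by eventually_elim (use c in \<open>auto simp: Y_def H_def\<close>)
  have EY: "ext_expectation M Y = threshold_value M f B c + ereal u"
    using ext_expectation_cong[OF Y] ext_expectation_threshold_bound[OF f B B0 c int Ec uz(1)] by simp
  have "profit f B u z = (\<lambda>\<omega>. f (max 0 (z (B \<omega>) + u)) - B \<omega> * z (B \<omega>))"
    using uz by (auto simp: profit_def fun_eq_iff add_nonneg_nonneg)
  then have [measurable]: "profit f B u z \<in> borel_measurable M" by simp
  have "AE \<omega> in M. profit f B u z \<omega> = Y \<omega>"
  proof (rule ext_expectation_eq_imp_AE_eq)
    show "AE \<omega> in M. profit f B u z \<omega> \<le> Y \<omega>"
      using B0 Y by eventually_elim (use profit_le_threshold_bound[OF f _ c uz] in auto)
    show "AE \<omega> in M. Y \<omega> \<ge> 0"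
      using B0 Y by eventually_elim (use c uz indirect_profit_nonneg[OF f] in auto)
    show "ext_expectation M Y < \<infinity>"
      using fin EY by simp
    have "ext_expectation M (profit f B u z) - ereal u = threshold_value M f B c"
      using obj by (simp add: objective_def)
    then show "ext_expectation M Y \<le> ext_expectation M (profit f B u z)"
      unfolding EY by (cases "ext_expectation M (profit f B u z)"; cases "threshold_value M f B c") auto
  qed measurable
  then have eq: "AE \<omega> in M. profit f B u z \<omega> = indirect_profit f (min (B \<omega>) c) + min (B \<omega>) c * u"
    using Y by eventually_elim simp
  have "\<not> (AE \<omega> in M. B \<omega> \<le> c)"
  proof
    assume "AE \<omega> in M. B \<omega> \<le> c"
    then have "AE \<omega> in M. B \<omega> = min (B \<omega>) c" by eventually_elim auto
    then have "expectation B = expectation (\<lambda>\<omega>. min (B \<omega>) c)" by (intro integral_cong_AE) auto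
    with Ec EB show False by simp
  qed
  moreover have "AE \<omega> in M. B \<omega> \<le> c" if "u \<noteq> demand f c"
    using eq
  proof eventually_elim
    case (elim \<omega>)
    show ?case
    proof (rule ccontr)
      assume "\<not> B \<omega> \<le> c"
      then have Bc: "B \<omega> > c" by simp
      define x where "x = z (B \<omega>)"
      have x: "x \<ge> 0" using uz by (simp add: x_def)
      \<comment> \<open>Equality in the bound, rewritten at the shadow price \<open>c\<close>.\<close>
      have e: "f (x + u) - c * (x + u) = indirect_profit f c + (B \<omega> - c) * x"
        using elim Bc by (simp add: profit_def x_def algebra_simps)
      have "(B \<omega> - c) * x \<ge> 0" using x Bc by simp
      moreover have "f (x + u) - c * (x + u) \<le> indirect_profit f c"
        using x uz by (intro profit_le_indirect_profit[OF f c]) auto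
      ultimately have "(B \<omega> - c) * x = 0" using e by linarith
      then have "x = 0" using Bc by simp
      then have "f u - c * u = indirect_profit f c" using e by simp
      then show False using profit_eq_indirect_profit_iff[OF f c uz(1)] that by simp
    qed
  qed
  ultimately show ?thesis by blast
qed

end

section \<open>Quadratic variation along a path\<close>

lemma abs_exp_minus_quadratic_le:
  fixes x :: real
  assumes "\<bar>x\<bar> \<le> 1"
  shows "\<bar>exp x - 1 - x - x\<^sup>2 / 2\<bar> \<le> 2 * \<bar>x\<bar> * x\<^sup>2"
proof -
  have "\<bar>exp x - (\<Sum>i\<le>2. x ^ i / fact i)\<bar> \<le> exp \<bar>x\<bar> * \<bar>x\<bar> ^ Suc 2 / fact 2"
    using Taylor_exp_field[of x 2] by simp
  also have "(\<Sum>i\<le>2. x ^ i / fact i) = 1 + x + x\<^sup>2 / 2"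
    by (simp add: numeral_2_eq_2)
  also have "exp \<bar>x\<bar> * \<bar>x\<bar> ^ Suc 2 / fact 2 \<le> 3 * \<bar>x\<bar> ^ Suc 2 / fact 2"
  proof (intro divide_right_mono mult_right_mono)
    have "exp \<bar>x\<bar> \<le> exp 1" using assms by simp
    then show "exp \<bar>x\<bar> \<le> 3" using exp_le by linarith
  qed auto
  also have "\<dots> \<le> 2 * \<bar>x\<bar> * x\<^sup>2"
    by (simp add: numeral_2_eq_2 abs_mult_self_eq) 
       (simp add: mult.assoc[symmetric])
  finally show ?thesis by (simp add: algebra_simps)
qed

lemma uniform_grid_increments_small:
  fixes g :: "real \<Rightarrow> real"
  assumes g: "continuous_on {0..T} g" and T: "T > 0" and e: "e > 0"
  shows "eventually (\<lambda>n. \<forall>i<Suc n. \<bar>g (T * Suc i / Suc n) - g (T * i / Suc n)\<bar> < e) sequentially"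
proof -
  have "uniformly_continuous_on {0..T} g"
    using compact_uniformly_continuous[OF g] by simp
  then obtain d where d: "d > 0"
    "\<And>x y. x \<in> {0..T} \<Longrightarrow> y \<in> {0..T} \<Longrightarrow> dist y x < d \<Longrightarrow> dist (g y) (g x) < e"
    unfolding uniformly_continuous_on_def using e by metis
  have "(\<lambda>n. T / real (Suc n)) \<longlonglongrightarrow> 0"
    using LIMSEQ_Suc[OF lim_const_over_n[of T]] by simp
  from order_tendstoD(2)[OF this d(1)] show ?thesis
  proof eventually_elim
    case (elim n)
    show ?case
    proof (intro allI impI)
      fix i assume i: "i < Suc n"
      have in1: "T * Suc i / Suc n \<in> {0..T}" "T * i / Suc n \<in> {0..T}"
        using i T by (auto simp: divide_simps simp del: of_nat_Suc)
      have "T * Suc i / Suc n - T * i / Suc n = T / Suc n"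
        by (simp add: diff_divide_distrib[symmetric] right_diff_distrib[symmetric])
      then have "dist (T * Suc i / Suc n) (T * i / Suc n) < d"
        using elim T by (simp add: dist_real_def)
      from d(2)[OF in1(2,1) this]
      show "\<bar>g (T * Suc i / Suc n) - g (T * i / Suc n)\<bar> < e" by (simp add: dist_real_def)
    qed
  qed
qed

text \<open>The pathwise core of solving the price equation without stochastic calculus. With \<open>L = ln b\<close> the
  Ito sums are \<open>\<Sum> (exp \<Delta>L - 1)\<close>, that is, \<open>L T + (1/2) \<Sum> (\<Delta>L)\<^sup>2\<close> up to a vanishing
  remainder. So the quadratic variation of \<open>L\<close> has to be found. The monotonicity hypothesis says
  that \<open>\<mu> t + \<sigma> w t - L t\<close> increases along grids; hence \<open>L - \<sigma> w\<close> has bounded variation. Being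
  continuous, it contributes nothing to the quadratic variation, and \<open>L\<close> inherits \<open>\<sigma>\<^sup>2 T\<close> from
  \<open>\<sigma> w\<close>.\<close>

lemma log_price_pathwise:
  fixes L w :: "real \<Rightarrow> real" and \<mu> \<sigma> T :: real and r :: "nat \<Rightarrow> nat"
  assumes T: "T > 0" and \<mu>: "\<mu> > 0" and \<sigma>: "\<sigma> > 0"
    and L: "continuous_on {0..T} L" "L 0 = 0" and w: "continuous_on {0..T} w" "w 0 = 0"
    and mono: "\<And>n i. i < Suc n \<Longrightarrow>
      L (T * Suc i / Suc n) - L (T * i / Suc n) \<le>
        \<mu> * (T / Suc n) + \<sigma> * (w (T * Suc i / Suc n) - w (T * i / Suc n))"
    and r: "strict_mono r"
    and ito: "(\<lambda>k. \<Sum>i<Suc (r k). exp (L (T * Suc i / Suc (r k)) - L (T * i / Suc (r k))) - 1)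
        \<longlonglongrightarrow> \<mu> * T + \<sigma> * w T"
    and qv: "(\<lambda>k. \<Sum>i<Suc (r k). (w (T * Suc i / Suc (r k)) - w (T * i / Suc (r k)))\<^sup>2) \<longlonglongrightarrow> T"
  shows "L T = (\<mu> - \<sigma>\<^sup>2 / 2) * T + \<sigma> * w T"
proof -
  define dL where "dL n i = L (T * Suc i / Suc n) - L (T * i / Suc n)" for n i
  define dw where "dw n i = w (T * Suc i / Suc n) - w (T * i / Suc n)" for n i
  have sum_tele: "(\<Sum>i<Suc n. g (T * Suc i / Suc n) - g (T * i / Suc n)) = g T - g 0" for g :: "real \<Rightarrow> real" and n
    using sum_lessThan_telescope[of "\<lambda>i. g (T * real i / Suc n)" "Suc n"] by simp
  have sumL: "(\<Sum>i<Suc n. dL n i) = L T" for n using sum_tele[of L n] L by (simp add: dL_def)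
  have sumw: "(\<Sum>i<Suc n. dw n i) = w T" for n using sum_tele[of w n] w by (simp add: dw_def)
  \<comment> \<open>\<open>K\<close> bounds the variation of \<open>L - \<sigma> w\<close>: the drift contributes \<open>\<mu> T\<close>, and the increasing part \<open>\<mu> T + \<sigma> w T - L T\<close>.\<close>
  define K where "K = 2 * \<mu> * T + \<sigma> * w T - L T"
  define a where "a n i = dL n i - \<sigma> * dw n i" for n i
  have a_abs: "\<bar>a n i\<bar> \<le> 2 * \<mu> * (T / Suc n) + \<sigma> * dw n i - dL n i" if "i < Suc n" for n i
    using mono[OF that] T \<mu> 
    by (auto simp: a_def dL_def dw_def abs_if field_simps)
  have sum_a: "(\<Sum>i<Suc n. \<bar>a n i\<bar>) \<le> K" for n
  proof -
    have "(\<Sum>i<Suc n. \<bar>a n i\<bar>) \<le> (\<Sum>i<Suc n. 2 * \<mu> * (T / Suc n) + \<sigma> * dw n i - dL n i)"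
      by (rule sum_mono) (use a_abs in auto)
    also have "\<dots> = (\<Sum>i<Suc n. 2 * \<mu> * (T / Suc n)) + \<sigma> * (\<Sum>i<Suc n. dw n i) - (\<Sum>i<Suc n. dL n i)"
      by (simp only: sum_subtractf sum.distrib sum_distrib_left)
    also have "(\<Sum>i<Suc n. 2 * \<mu> * (T / Suc n)) = 2 * \<mu> * T"
      by (simp del: sum.lessThan_Suc of_nat_Suc)
    finally show ?thesis by (simp only: sumL sumw K_def)
  qed
  have K: "K \<ge> 0" using sum_a[of 0] by (smt (verit) sum_nonneg abs_ge_zero)
  have small: "eventually (\<lambda>n. \<forall>i<Suc n. \<bar>dL n i\<bar> < e \<and> \<bar>dw n i\<bar> < e) sequentially" if "e > 0" for e
    using uniform_grid_increments_small[OF L(1) T that] uniform_grid_increments_small[OF w(1) T that]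
    by eventually_elim (auto simp: dL_def dw_def)
  have cross: "(\<lambda>n. (\<Sum>i<Suc n. (dL n i)\<^sup>2) - \<sigma>\<^sup>2 * (\<Sum>i<Suc n. (dw n i)\<^sup>2)) \<longlonglongrightarrow> 0"
  proof (rule LIMSEQ_I)
    fix e :: real assume e: "e > 0"
    \<comment> \<open>The difference of the two squares is \<open>a * (dL + \<sigma> * dw)\<close>; the second factor is at most \<open>(1 + \<sigma>) * d\<close>, and the \<open>\<bar>a\<bar>\<close> add up to at most \<open>K\<close>. The \<open>+ 1\<close> avoids dividing by zero.\<close>
    define d where "d = e / ((1 + \<sigma>) * (K + 1))"
    have d: "d > 0" using e \<sigma> K by (simp add: d_def)
    have dK: "(1 + \<sigma>) * d * K < e"
    proof -
      have "(1 + \<sigma>) * d = e / (K + 1)" using \<sigma> K by (simp add: d_def)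
      then have "(1 + \<sigma>) * d * K = e * (K / (K + 1))" by simp
      also have "\<dots> < e * 1" using e K by (intro mult_strict_left_mono) auto
      finally show ?thesis by simp
    qed
    have "eventually (\<lambda>n. norm ((\<Sum>i<Suc n. (dL n i)\<^sup>2) - \<sigma>\<^sup>2 * (\<Sum>i<Suc n. (dw n i)\<^sup>2) - 0) < e) sequentially"
      using small[OF d]
    proof eventually_elim
      case (elim n)
      have "(\<Sum>i<Suc n. (dL n i)\<^sup>2) - \<sigma>\<^sup>2 * (\<Sum>i<Suc n. (dw n i)\<^sup>2)
          = (\<Sum>i<Suc n. a n i * (dL n i + \<sigma> * dw n i))"
        unfolding sum_distrib_left sum_subtractf[symmetric]
        by (intro sum.cong) (auto simp: a_def power2_eq_square algebra_simps)
      also have "\<bar>\<dots>\<bar> \<le> (\<Sum>i<Suc n. \<bar>a n i * (dL n i + \<sigma> * dw n i)\<bar>)" by (rule sum_abs)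
      also have "\<dots> \<le> (\<Sum>i<Suc n. \<bar>a n i\<bar> * ((1 + \<sigma>) * d))"
      proof (rule sum_mono)
        fix i assume "i \<in> {..<Suc n}"
        then have b: "\<bar>dL n i\<bar> \<le> d" "\<bar>dw n i\<bar> \<le> d" using elim by (auto intro: less_imp_le)
        have "\<bar>dL n i + \<sigma> * dw n i\<bar> \<le> \<bar>dL n i\<bar> + \<sigma> * \<bar>dw n i\<bar>"
          using abs_triangle_ineq[of "dL n i" "\<sigma> * dw n i"] \<sigma> by (simp add: abs_mult)
        also have "\<dots> \<le> d + \<sigma> * d" using b \<sigma> by (intro add_mono mult_left_mono) auto
        finally have "\<bar>dL n i + \<sigma> * dw n i\<bar> \<le> (1 + \<sigma>) * d" by (simp add: algebra_simps)
        then show "\<bar>a n i * (dL n i + \<sigma> * dw n i)\<bar> \<le> \<bar>a n i\<bar> * ((1 + \<sigma>) * d)"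
          by (simp add: abs_mult mult_left_mono)
      qed
      also have "\<dots> = (\<Sum>i<Suc n. \<bar>a n i\<bar>) * ((1 + \<sigma>) * d)" by (simp only: sum_distrib_right)
      also have "\<dots> \<le> K * ((1 + \<sigma>) * d)" using sum_a d \<sigma> by (intro mult_right_mono) auto
      also have "\<dots> < e" using dK by (simp only: ac_simps)
      finally show ?case by simp
    qed
    then show "\<exists>no. \<forall>n\<ge>no. norm ((\<Sum>i<Suc n. (dL n i)\<^sup>2) - \<sigma>\<^sup>2 * (\<Sum>i<Suc n. (dw n i)\<^sup>2) - 0) < e"
      unfolding eventually_sequentially .
  qed
  have qvL: "(\<lambda>k. \<Sum>i<Suc (r k). (dL (r k) i)\<^sup>2) \<longlonglongrightarrow> \<sigma>\<^sup>2 * T"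
  proof -
    have "(\<lambda>k. \<sigma>\<^sup>2 * (\<Sum>i<Suc (r k). (dw (r k) i)\<^sup>2)) \<longlonglongrightarrow> \<sigma>\<^sup>2 * T"
      using qv unfolding dw_def by (rule tendsto_mult_left)
    from tendsto_add[OF LIMSEQ_subseq_LIMSEQ[OF cross r, unfolded o_def] this]
    show ?thesis by simp
  qed
  have rem: "(\<lambda>k. \<Sum>i<Suc (r k). exp (dL (r k) i) - 1 - dL (r k) i - (dL (r k) i)\<^sup>2 / 2) \<longlonglongrightarrow> 0"
  proof (rule LIMSEQ_I)
    fix e :: real assume e: "e > 0"
    define C where "C = \<sigma>\<^sup>2 * T + 1"
    have C: "C > 0" using T by (simp add: C_def add_nonneg_pos)
    define d where "d = min 1 (e / (4 * C))"
    have d: "d > 0" "d \<le> 1" using e C by (auto simp: d_def)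
    have dC: "2 * d * C < e"
    proof -
      have "2 * d * C \<le> 2 * (e / (4 * C)) * C"
        using C by (intro mult_right_mono mult_left_mono) (auto simp: d_def)
      also have "\<dots> < e" using C e by simp
      finally show ?thesis .
    qed
    have "eventually (\<lambda>k. (\<Sum>i<Suc (r k). (dL (r k) i)\<^sup>2) < C) sequentially"
      by (rule order_tendstoD(2)[OF qvL]) (simp add: C_def)
    moreover have "eventually (\<lambda>k. \<forall>i<Suc (r k). \<bar>dL (r k) i\<bar> < d \<and> \<bar>dw (r k) i\<bar> < d) sequentially"
      by (rule eventually_subseq[OF r small[OF d(1)]])
    ultimately have "eventually (\<lambda>k. norm ((\<Sum>i<Suc (r k). exp (dL (r k) i) - 1 - dL (r k) i - (dL (r k) i)\<^sup>2 / 2) - 0) < e) sequentially"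
    proof eventually_elim
      case (elim k)
      let ?n = "r k"
      have "\<bar>\<Sum>i<Suc ?n. exp (dL ?n i) - 1 - dL ?n i - (dL ?n i)\<^sup>2 / 2\<bar>
          \<le> (\<Sum>i<Suc ?n. \<bar>exp (dL ?n i) - 1 - dL ?n i - (dL ?n i)\<^sup>2 / 2\<bar>)" by (rule sum_abs)
      also have "\<dots> \<le> (\<Sum>i<Suc ?n. 2 * d * (dL ?n i)\<^sup>2)"
      proof (rule sum_mono)
        fix i assume "i \<in> {..<Suc ?n}"
        then have b: "\<bar>dL ?n i\<bar> \<le> d" using elim by (auto intro: less_imp_le)
        then have "\<bar>exp (dL ?n i) - 1 - dL ?n i - (dL ?n i)\<^sup>2 / 2\<bar> \<le> 2 * \<bar>dL ?n i\<bar> * (dL ?n i)\<^sup>2"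
          using d by (intro abs_exp_minus_quadratic_le) auto
        also have "\<dots> \<le> 2 * d * (dL ?n i)\<^sup>2" using b by (intro mult_right_mono mult_left_mono) auto
        finally show "\<bar>exp (dL ?n i) - 1 - dL ?n i - (dL ?n i)\<^sup>2 / 2\<bar> \<le> 2 * d * (dL ?n i)\<^sup>2" .
      qed
      also have "\<dots> = 2 * d * (\<Sum>i<Suc ?n. (dL ?n i)\<^sup>2)" by (simp only: sum_distrib_left)
      also have "\<dots> \<le> 2 * d * C" using elim d by (intro mult_left_mono) auto
      also note dC
      finally show ?case by simp
    qed
    then show "\<exists>no. \<forall>k\<ge>no. norm ((\<Sum>i<Suc (r k). exp (dL (r k) i) - 1 - dL (r k) i - (dL (r k) i)\<^sup>2 / 2) - 0) < e"
      unfolding eventually_sequentially .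
  qed
  have "(\<lambda>k. (\<Sum>i<Suc (r k). exp (dL (r k) i) - 1 - dL (r k) i - (dL (r k) i)\<^sup>2 / 2) + L T
      + (\<Sum>i<Suc (r k). (dL (r k) i)\<^sup>2) / 2) \<longlonglongrightarrow> 0 + L T + \<sigma>\<^sup>2 * T / 2"
    by (intro tendsto_intros rem qvL) simp
  moreover have "(\<Sum>i<Suc n. exp (dL n i) - 1 - dL n i - (dL n i)\<^sup>2 / 2) + L T + (\<Sum>i<Suc n. (dL n i)\<^sup>2) / 2
      = (\<Sum>i<Suc n. exp (dL n i) - 1)" for n
    by (simp only: sumL[of n, symmetric] sum_divide_distrib sum.distrib[symmetric]) simp
  ultimately have "(\<lambda>k. \<Sum>i<Suc (r k). exp (dL (r k) i) - 1) \<longlonglongrightarrow> 0 + L T + \<sigma>\<^sup>2 * T / 2"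
    by (simp only:)
  from LIMSEQ_unique[OF this ito[folded dL_def]] show ?thesis
    by (simp add: algebra_simps)
qed

section \<open>Riemann sums along almost surely convergent subsequences\<close>

lemma tendsto_zero_of_min_abs:
  fixes x :: "nat \<Rightarrow> real"
  assumes "(\<lambda>n. min 1 \<bar>x n\<bar>) \<longlonglongrightarrow> 0"
  shows "x \<longlonglongrightarrow> 0"
proof (rule tendsto_rabs_zero_cancel)
  have "eventually (\<lambda>n. min 1 \<bar>x n\<bar> < 1) sequentially"
    using assms by (rule order_tendstoD(2)) simp
  then have "eventually (\<lambda>n. min 1 \<bar>x n\<bar> = \<bar>x n\<bar>) sequentially"
    by eventually_elim auto
  from Lim_transform_eventually[OF assms this] show "(\<lambda>n. \<bar>x n\<bar>) \<longlonglongrightarrow> 0" .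
qed

context prob_space
begin

text \<open>Convergence in probability, recast as convergence of the means of a truncated distance. In this
  form several sequences can be added up to yield one almost surely convergent subsequence for all
  of them, as in \<open>AE_common_subseq\<close>.\<close>

lemma expectation_min_abs_tendsto_zero:
  fixes X :: "nat \<Rightarrow> 'a \<Rightarrow> real"
  assumes [measurable]: "\<And>n. X n \<in> borel_measurable M"
    and small: "\<And>\<epsilon> \<delta>. \<epsilon> > 0 \<Longrightarrow> \<delta> > 0 \<Longrightarrow>
      eventually (\<lambda>n. prob {\<omega>\<in>space M. \<bar>X n \<omega>\<bar> > \<epsilon>} < \<delta>) sequentially"
  shows "(\<lambda>n. expectation (\<lambda>\<omega>. min 1 \<bar>X n \<omega>\<bar>)) \<longlonglongrightarrow> 0"
proof (rule LIMSEQ_I)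
  fix e :: real assume e: "e > 0"
  have "eventually (\<lambda>n. norm (expectation (\<lambda>\<omega>. min 1 \<bar>X n \<omega>\<bar>) - 0) < e) sequentially"
    using small[OF half_gt_zero[OF e] half_gt_zero[OF e]]
  proof eventually_elim
    case (elim n)
    have "expectation (\<lambda>\<omega>. min 1 \<bar>X n \<omega>\<bar>)
        \<le> expectation (\<lambda>\<omega>. e / 2 + indicator {\<omega>\<in>space M. \<bar>X n \<omega>\<bar> > e / 2} \<omega>)"
    proof (rule integral_mono)
      show "integrable M (\<lambda>\<omega>. min 1 \<bar>X n \<omega>\<bar>)"
        by (rule integrable_const_bound[where B = 1]) auto
      show "integrable M (\<lambda>\<omega>. e / 2 + indicator {\<omega>\<in>space M. \<bar>X n \<omega>\<bar> > e / 2} \<omega>)"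
        by (rule integrable_const_bound[where B = "e + 1"])
           (use e in \<open>auto simp: indicator_def\<close>)
    qed (use e in \<open>auto simp: indicator_def\<close>)
    also have "\<dots> = e / 2 + prob {\<omega>\<in>space M. \<bar>X n \<omega>\<bar> > e / 2}"
      by (subst Bochner_Integration.integral_add)
         (auto simp: prob_space less_top[symmetric] intro!: integrable_real_indicator)
    finally have "expectation (\<lambda>\<omega>. min 1 \<bar>X n \<omega>\<bar>) < e" using elim by simp
    moreover have "expectation (\<lambda>\<omega>. min 1 \<bar>X n \<omega>\<bar>) \<ge> 0" by (rule integral_nonneg_AE) auto
    ultimately show ?case by simp
  qed
  then show "\<exists>no. \<forall>n\<ge>no. norm (expectation (\<lambda>\<omega>. min 1 \<bar>X n \<omega>\<bar>) - 0) < e"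
    unfolding eventually_sequentially .
qed

lemma AE_common_subseq:
  fixes X Y :: "nat \<Rightarrow> 'a \<Rightarrow> real"
  assumes [measurable]: "\<And>n. X n \<in> borel_measurable M" and Y: "\<And>n. integrable M (Y n)"
    and Y0: "\<And>n \<omega>. Y n \<omega> \<ge> 0"
    and EX: "(\<lambda>n. expectation (\<lambda>\<omega>. min 1 \<bar>X n \<omega>\<bar>)) \<longlonglongrightarrow> 0"
    and EY: "(\<lambda>n. expectation (Y n)) \<longlonglongrightarrow> 0"
  obtains r :: "nat \<Rightarrow> nat" where "strict_mono r"
    "AE \<omega> in M. (\<lambda>n. X (r n) \<omega>) \<longlonglongrightarrow> 0" "AE \<omega> in M. (\<lambda>n. Y (r n) \<omega>) \<longlonglongrightarrow> 0"
proof -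
  have intX: "integrable M (\<lambda>\<omega>. min 1 \<bar>X n \<omega>\<bar>)" for n
    by (rule integrable_const_bound[where B = 1]) auto
  have "(\<lambda>n. expectation (\<lambda>\<omega>. norm (min 1 \<bar>X n \<omega>\<bar> + Y n \<omega>))) \<longlonglongrightarrow> 0"
    using tendsto_add[OF EX EY] intX Y Y0 by simp
  with intX Y obtain r :: "nat \<Rightarrow> nat" where r: "strict_mono r"
    and ae: "AE \<omega> in M. (\<lambda>n. min 1 \<bar>X (r n) \<omega>\<bar> + Y (r n) \<omega>) \<longlonglongrightarrow> 0"
    using tendsto_L1_AE_subseq[of M "\<lambda>n \<omega>. min 1 \<bar>X n \<omega>\<bar> + Y n \<omega>"] by auto
  have "AE \<omega> in M. (\<lambda>n. X (r n) \<omega>) \<longlonglongrightarrow> 0"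
    using ae
  proof eventually_elim
    case (elim \<omega>)
    have "(\<lambda>n. min 1 \<bar>X (r n) \<omega>\<bar>) \<longlonglongrightarrow> 0"
      by (rule tendsto_sandwich[OF _ _ tendsto_const elim]) (use Y0 in auto)
    then show ?case by (rule tendsto_zero_of_min_abs)
  qed
  moreover have "AE \<omega> in M. (\<lambda>n. Y (r n) \<omega>) \<longlonglongrightarrow> 0"
    using ae
  proof eventually_elim
    case (elim \<omega>)
    show ?case
      by (rule tendsto_sandwich[OF _ _ tendsto_const elim]) (use Y0 in auto)
  qed
  ultimately show ?thesis using r that by blast
qed

text \<open>The grid of step \<open>h / Suc n\<close> refines the multiples of \<open>h\<close>. Its restriction to \<open>[0, h * j]\<close>
  is a legitimate partition for every \<open>j\<close>, so that the sums up to \<open>h * j\<close> and \<open>h * Suc j\<close> share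
  their terms and can be subtracted.\<close>

lemma ito_integral_uniform_grid:
  fixes H X :: "real \<Rightarrow> 'a \<Rightarrow> real" and h :: real and j :: nat
  assumes ito: "has_ito_integral M H X (h * j) I" and h: "h > 0"
    and H: "\<And>t. t \<ge> 0 \<Longrightarrow> H t \<in> borel_measurable M"
    and X: "\<And>t. t \<ge> 0 \<Longrightarrow> X t \<in> borel_measurable M" and [measurable]: "I \<in> borel_measurable M"
  shows "(\<lambda>n. expectation (\<lambda>\<omega>. min 1 \<bar>(\<Sum>i<j * Suc n. H (h * i / Suc n) \<omega> *
    (X (h * Suc i / Suc n) \<omega> - X (h * i / Suc n) \<omega>)) - I \<omega>\<bar>)) \<longlonglongrightarrow> 0"
proof -
  define S where "S = (\<lambda>n \<omega>. (\<Sum>i<j * Suc n. H (h * i / Suc n) \<omega> *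
    (X (h * Suc i / Suc n) \<omega> - X (h * i / Suc n) \<omega>)) - I \<omega>)"
  have nn: "0 \<le> h * real i / real (Suc n)" for i n
    using h by simp
  have S_meas: "S n \<in> borel_measurable M" for n
    unfolding S_def
    by (intro borel_measurable_diff borel_measurable_sum borel_measurable_times H X nn) fact
  have "eventually (\<lambda>n. prob {\<omega> \<in> space M. \<bar>S n \<omega>\<bar> > e} < d) sequentially"
    if ed: "e > 0" "d > 0" for e d
  proof -
    obtain \<eta> where \<eta>: "\<eta> > 0" and le: "\<And>(n::nat) (s::nat \<Rightarrow> real).
        s 0 = 0 \<and> s n = h * j \<and> (\<forall>i<n. s i \<le> s (Suc i) \<and> s (Suc i) - s i < \<eta>) \<Longrightarrow>
        prob {\<omega> \<in> space M.
          \<bar>(\<Sum>i<n. H (s i) \<omega> * (X (s (Suc i)) \<omega> - X (s i) \<omega>)) - I \<omega>\<bar> > e} < d"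
      using ito[unfolded has_ito_integral_def, rule_format, OF ed] by blast
    have "(\<lambda>n. h / real (Suc n)) \<longlonglongrightarrow> 0"
      using LIMSEQ_Suc[OF lim_const_over_n[of h]] by simp
    from order_tendstoD(2)[OF this \<eta>] show ?thesis
    proof eventually_elim
      case (elim n)
      define s where "s i = h * real i / Suc n" for i :: nat
      have "s (Suc i) - s i = h / Suc n" for i
        unfolding s_def by (simp add: diff_divide_distrib[symmetric] right_diff_distrib[symmetric])
      moreover have "s i \<le> s (Suc i)" for i
        unfolding s_def using h by (intro divide_right_mono mult_left_mono) auto
      moreover have "s (j * Suc n) = h * j" "s 0 = 0"
        unfolding s_def of_nat_mult by (simp_all del: of_nat_Suc)
      ultimately have "prob {\<omega> \<in> space M. \<bar>(\<Sum>i<j * Suc n. H (s i) \<omega> *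
          (X (s (Suc i)) \<omega> - X (s i) \<omega>)) - I \<omega>\<bar> > e} < d"
        using elim by (intro le) simp
      then show ?case unfolding S_def s_def .
    qed
  qed
  from expectation_min_abs_tendsto_zero[of S, OF S_meas this] show ?thesis
    unfolding S_def .
qed

lemma expectation_power2_sum_orthogonal:
  fixes V :: "nat \<Rightarrow> 'a \<Rightarrow> real"
  assumes int: "\<And>i j. i < n \<Longrightarrow> j < n \<Longrightarrow> integrable M (\<lambda>\<omega>. V i \<omega> * V j \<omega>)"
    and orth: "\<And>i j. i < j \<Longrightarrow> j < n \<Longrightarrow> expectation (\<lambda>\<omega>. V i \<omega> * V j \<omega>) = 0"
    and sq: "\<And>i. i < n \<Longrightarrow> expectation (\<lambda>\<omega>. V i \<omega> * V i \<omega>) = c"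
  shows "integrable M (\<lambda>\<omega>. (\<Sum>i<n. V i \<omega>)\<^sup>2)"
    and "expectation (\<lambda>\<omega>. (\<Sum>i<n. V i \<omega>)\<^sup>2) = n * c"
proof -
  have eq: "(\<Sum>i<n. V i \<omega>)\<^sup>2 = (\<Sum>i<n. \<Sum>j<n. V i \<omega> * V j \<omega>)" for \<omega>
    by (simp add: power2_eq_square sum_product)
  show "integrable M (\<lambda>\<omega>. (\<Sum>i<n. V i \<omega>)\<^sup>2)" unfolding eq by (intro Bochner_Integration.integrable_sum) (auto intro: int)
  have E: "expectation (\<lambda>\<omega>. V i \<omega> * V j \<omega>) = (if i = j then c else 0)" if "i < n" "j < n" for i j
    using orth[of i j] orth[of j i] sq[of i] that by (cases i j rule: linorder_cases) (auto simp: mult.commute)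
  have "expectation (\<lambda>\<omega>. (\<Sum>i<n. V i \<omega>)\<^sup>2) = (\<Sum>i<n. \<Sum>j<n. expectation (\<lambda>\<omega>. V i \<omega> * V j \<omega>))"
    unfolding eq
    by (subst Bochner_Integration.integral_sum, force intro: Bochner_Integration.integrable_sum int,
        intro sum.cong refl Bochner_Integration.integral_sum int) auto
  also have "\<dots> = (\<Sum>i<n. \<Sum>j<n. if i = j then c else 0)"
    using E by (intro sum.cong) auto
  finally show "expectation (\<lambda>\<omega>. (\<Sum>i<n. V i \<omega>)\<^sup>2) = n * c" by simp
qed

end

section \<open>Moments and quadratic variation of the Wiener process\<close>

context prob_space
begin

lemma wiener_measurable:
  assumes "wiener_process M F w" "t \<ge> 0"
  shows "w t \<in> borel_measurable M"
  using assms unfolding wiener_process_def filtration_def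
  by (intro measurable_from_subalg[of M "F t"]) (auto simp: subalgebra_def)

lemma wiener_increment_moments:
  assumes w: "wiener_process M F w" and st: "0 \<le> s" "s < t"
  defines "V \<equiv> \<lambda>\<omega>. (w t \<omega> - w s \<omega>)\<^sup>2 - (t - s)"
  shows "integrable M V" "expectation V = 0"
    "integrable M (\<lambda>\<omega>. V \<omega> * V \<omega>)" "expectation (\<lambda>\<omega>. V \<omega> * V \<omega>) = 2 * (t - s)\<^sup>2"
proof -
  let ?D = "\<lambda>\<omega>. w t \<omega> - w s \<omega>"
  have d: "distributed M lborel ?D (normal_density 0 (sqrt (t - s)))"
    using w st unfolding wiener_process_def by simp
  have pos: "sqrt (t - s) > 0" using st by simp
  have mom: "integrable M (\<lambda>\<omega>. ?D \<omega> ^ (2 * k))"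
      "expectation (\<lambda>\<omega>. ?D \<omega> ^ (2 * k)) = fact (2 * k) / ((2 / (t - s)) ^ k * fact k)" for k
    using distributed_integrable[OF d, of "\<lambda>x. x ^ (2 * k)"] distributed_integral[OF d, of "\<lambda>x. x ^ (2 * k)"]
      integrable_normal_moment[OF pos, of 0 "2 * k"] integral_normal_moment_even[OF pos, of 0 k] st
    by auto
  have m2: "integrable M (\<lambda>\<omega>. (?D \<omega>)\<^sup>2)" "expectation (\<lambda>\<omega>. (?D \<omega>)\<^sup>2) = t - s"
    using mom[of 1] st by (auto simp: numeral_2_eq_2)
  have m4: "integrable M (\<lambda>\<omega>. ?D \<omega> ^ 4)" "expectation (\<lambda>\<omega>. ?D \<omega> ^ 4) = 3 * (t - s)\<^sup>2"
    using mom[of 2] st by (auto simp: fact_numeral power_divide power2_eq_square)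
  show "integrable M V" "expectation V = 0"
    unfolding V_def using m2 by (auto simp: prob_space)
  have eq: "V \<omega> * V \<omega> = ?D \<omega> ^ 4 - 2 * (t - s) * (?D \<omega>)\<^sup>2 + (t - s)\<^sup>2" for \<omega>
    unfolding V_def by (simp add: power2_eq_square power4_eq_xxxx algebra_simps)
  show "integrable M (\<lambda>\<omega>. V \<omega> * V \<omega>)" unfolding eq using m2 m4 by auto
  show "expectation (\<lambda>\<omega>. V \<omega> * V \<omega>) = 2 * (t - s)\<^sup>2"
    unfolding eq using m2 m4 by (simp add: prob_space power2_eq_square)
qed

lemma wiener_indep_increments:
  assumes w: "wiener_process M F w" and st: "0 \<le> r" "r \<le> s" "s \<le> t" "t < u"
  shows "indep_var borel (\<lambda>\<omega>. w s \<omega> - w r \<omega>) borel (\<lambda>\<omega>. w u \<omega> - w t \<omega>)"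
proof -
  have [measurable]: "w v \<in> borel_measurable M" if "v \<ge> 0" for v
    using wiener_measurable[OF w that] .
  have fil: "filtration (space M) F" and ad: "\<And>v. v \<ge> 0 \<Longrightarrow> w v \<in> borel_measurable (F v)"
    using w unfolding wiener_process_def by auto
  have adt: "w v \<in> borel_measurable (F t)" if "0 \<le> v" "v \<le> t" for v
    using ad[OF that(1)] fil that unfolding filtration_def
    by (intro measurable_from_subalg[of "F t" "F v"]) (auto simp: subalgebra_def)
  have D: "(\<lambda>\<omega>. w s \<omega> - w r \<omega>) \<in> borel_measurable (F t)"
    using adt[of s] adt[of r] st by (intro borel_measurable_diff) auto
  have spF: "space (F t) = space M" using fil by (simp add: filtration_def)
  have ind: "indep_set (sets (F t)) (sets (vimage_algebra (space M) (\<lambda>\<omega>. w u \<omega> - w t \<omega>) borel))"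
    using w st unfolding wiener_process_def by auto
  have "indep_set (sigma_sets (space M) {(\<lambda>\<omega>. w s \<omega> - w r \<omega>) -` A \<inter> space M |A. A \<in> sets borel})
     (sigma_sets (space M) {(\<lambda>\<omega>. w u \<omega> - w t \<omega>) -` A \<inter> space M |A. A \<in> sets borel})"
    unfolding indep_set_def
  proof (rule indep_sets_mono[OF ind[unfolded indep_set_def] subset_refl])
    fix i :: bool
    have "sigma_sets (space M) {(\<lambda>\<omega>. w s \<omega> - w r \<omega>) -` A \<inter> space M |A. A \<in> sets borel} \<subseteq> sets (F t)"
    proof -
      have "{(\<lambda>\<omega>. w s \<omega> - w r \<omega>) -` A \<inter> space M |A. A \<in> sets borel} \<subseteq> sets (F t)"
        using measurable_sets[OF D] by (auto simp: spF)
      from sets.sigma_sets_subset[OF this] show ?thesis by (simp only: spF)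
    qed
    then show "case_bool (sigma_sets (space M) {(\<lambda>\<omega>. w s \<omega> - w r \<omega>) -` A \<inter> space M |A. A \<in> sets borel})
        (sigma_sets (space M) {(\<lambda>\<omega>. w u \<omega> - w t \<omega>) -` A \<inter> space M |A. A \<in> sets borel}) i
      \<subseteq> case_bool (sets (F t)) (sets (vimage_algebra (space M) (\<lambda>\<omega>. w u \<omega> - w t \<omega>) borel)) i"
      by (cases i) (simp_all add: sets_vimage_algebra)
  qed
  then show ?thesis
    unfolding indep_var_eq using st by auto
qed

text \<open>The centred squared increments are orthogonal with variance \<open>2 (T / N)\<^sup>2\<close> on a grid of \<open>N\<close> steps,
  so the mean square error of their sum is \<open>2 T\<^sup>2 / N\<close>. \<open>Y\<close> is the squared error itself, whose
  mean is at hand exactly.\<close>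

lemma wiener_quadratic_variation:
  fixes T :: real
  assumes w: "wiener_process M F w" and T: "T > 0"
  defines "Y \<equiv> \<lambda>n \<omega>. ((\<Sum>i<Suc n. (w (T * Suc i / Suc n) \<omega> - w (T * i / Suc n) \<omega>)\<^sup>2) - T)\<^sup>2"
  shows "integrable M (Y n)" and "(\<lambda>n. expectation (Y n)) \<longlonglongrightarrow> 0"
proof -
  define V where "V n i = (\<lambda>\<omega>. (w (T * real (Suc i) / Suc n) \<omega> - w (T * real i / Suc n) \<omega>)\<^sup>2 - T / Suc n)" for n i
  have eq: "Y n = (\<lambda>\<omega>. (\<Sum>i<Suc n. V n i \<omega>)\<^sup>2)" for n
    unfolding V_def Y_def by (simp add: sum_subtractf del: sum.lessThan_Suc of_nat_Suc)
  have step: "T * real (Suc i) / Suc n - T * real i / Suc n = T / Suc n" for i n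
    by (simp add: diff_divide_distrib[symmetric] right_diff_distrib[symmetric])
  have le: "T * real i / Suc n \<le> T * real j / Suc n" if "i \<le> j" for i j n
    using T that by (intro divide_right_mono mult_left_mono) auto
  have lt: "T * real i / Suc n < T * real (Suc i) / Suc n" for i n
    using T by (intro divide_strict_right_mono mult_strict_left_mono) auto
  have nn: "0 \<le> T * real i / Suc n" for i n using T by simp
  have m: "integrable M (V n i)" "expectation (V n i) = 0"
    "integrable M (\<lambda>\<omega>. V n i \<omega> * V n i \<omega>)"
    "expectation (\<lambda>\<omega>. V n i \<omega> * V n i \<omega>) = 2 * (T / Suc n)\<^sup>2" for n i
    using wiener_increment_moments[OF w nn lt, of i n] unfolding step V_def by - assumption+
  have prod: "integrable M (\<lambda>\<omega>. V n i \<omega> * V n j \<omega>)" "expectation (\<lambda>\<omega>. V n i \<omega> * V n j \<omega>) = 0"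
    if "i < j" for i j n
  proof -
    have "indep_var borel ((\<lambda>x. x\<^sup>2 - T / Suc n) \<circ> (\<lambda>\<omega>. w (T * real (Suc i) / Suc n) \<omega> - w (T * real i / Suc n) \<omega>))
       borel ((\<lambda>x. x\<^sup>2 - T / Suc n) \<circ> (\<lambda>\<omega>. w (T * real (Suc j) / Suc n) \<omega> - w (T * real j / Suc n) \<omega>))"
      by (rule indep_var_compose[OF wiener_indep_increments[OF w nn less_imp_le[OF lt] le lt]])
         (use that in \<open>auto simp: Suc_le_eq\<close>)
    then have ind: "indep_var borel (V n i) borel (V n j)"
      by (simp add: V_def o_def)
    show "integrable M (\<lambda>\<omega>. V n i \<omega> * V n j \<omega>)" "expectation (\<lambda>\<omega>. V n i \<omega> * V n j \<omega>) = 0"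
      using indep_var_integrable[OF ind m(1) m(1)] indep_var_lebesgue_integral[OF ind m(1) m(1)] m(2)
      by auto
  qed
  have int: "integrable M (\<lambda>\<omega>. V n i \<omega> * V n j \<omega>)" for i j n
    using prod(1)[of i j n] prod(1)[of j i n] m(3)[of n i]
    by (cases i j rule: linorder_cases) (auto simp: mult.commute)
  note E = expectation_power2_sum_orthogonal[of "Suc n" "V n" for n, OF int prod(2) m(4)]
  show "integrable M (Y n)" unfolding eq by (rule E(1)) auto
  have "expectation (Y n) = 2 * T\<^sup>2 / Suc n" for n
    unfolding eq using E(2)[of n] by (simp add: power_divide power2_eq_square del: sum.lessThan_Suc of_nat_Suc)
  then show "(\<lambda>n. expectation (Y n)) \<longlonglongrightarrow> 0"
    using LIMSEQ_Suc[OF lim_const_over_n[of "2 * T\<^sup>2"]] by simp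
qed

end

section \<open>The price is a geometric Brownian motion\<close>

context prob_space
begin

lemma price_measurable:
  assumes "wiener_process M F w" "price_process M F w \<mu> \<sigma> b" "t \<ge> 0"
  shows "b t \<in> borel_measurable M"
  using assms unfolding wiener_process_def filtration_def price_process_def
  by (intro measurable_from_subalg[of M "F t"]) (auto simp: subalgebra_def)

lemma price_return_sums_uniform_grid:
  fixes h :: real and j :: nat
  assumes w: "wiener_process M F w" and b: "price_process M F w \<mu> \<sigma> b" and h: "h > 0"
  defines "S \<equiv> \<lambda>n \<omega>. (\<Sum>i<j * Suc n. 1 / b (h * i / Suc n) \<omega> *
    (b (h * Suc i / Suc n) \<omega> - b (h * i / Suc n) \<omega>)) - (\<mu> * (h * j) + \<sigma> * w (h * j) \<omega>)"
  shows "S n \<in> borel_measurable M" and "(\<lambda>n. expectation (\<lambda>\<omega>. min 1 \<bar>S n \<omega>\<bar>)) \<longlonglongrightarrow> 0"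
proof -
  note bm = price_measurable[OF w b] and wm = wiener_measurable[OF w]
  have nn: "0 \<le> h * real i / real (Suc n)" "0 \<le> h * real j" for i n
    using h by simp_all
  have inv: "(\<lambda>\<omega>. 1 / b t \<omega>) \<in> borel_measurable M" if "t \<ge> 0" for t
    using bm[OF that] by measurable
  have I: "(\<lambda>\<omega>. \<mu> * (h * j) + \<sigma> * w (h * j) \<omega>) \<in> borel_measurable M"
    using wm[OF nn(2)] by measurable
  show "S n \<in> borel_measurable M"
    unfolding S_def
    by (intro borel_measurable_diff borel_measurable_sum borel_measurable_times bm inv nn I)
  have "has_ito_integral M (\<lambda>s \<omega>. 1 / b s \<omega>) b (h * j) (\<lambda>\<omega>. \<mu> * (h * j) + \<sigma> * w (h * j) \<omega>)"
    using b nn(2) unfolding price_process_def by blast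
  from ito_integral_uniform_grid[OF this h inv bm I]
  show "(\<lambda>n. expectation (\<lambda>\<omega>. min 1 \<bar>S n \<omega>\<bar>)) \<longlonglongrightarrow> 0"
    unfolding S_def .
qed

text \<open>The elementary inequality \<open>ln y - ln x \<le> (y - x) / x\<close>, summed over an ever finer partition of
  \<open>[h * j, h * Suc j]\<close>: the logarithms telescope, and the right-hand sides tend to the Ito integral.
  This supplies the monotonicity hypothesis of \<open>log_price_pathwise\<close>.\<close>

lemma log_price_increment_le:
  fixes h :: real and j :: nat
  assumes w: "wiener_process M F w" and b: "price_process M F w \<mu> \<sigma> b" and h: "h > 0"
  shows "AE \<omega> in M. ln (b (h * Suc j) \<omega>) - ln (b (h * j) \<omega>) \<le>
    \<mu> * h + \<sigma> * (w (h * Suc j) \<omega> - w (h * j) \<omega>)"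
proof -
  define S where "S j = (\<lambda>n \<omega>. (\<Sum>i<j * Suc n. 1 / b (h * i / Suc n) \<omega> *
    (b (h * Suc i / Suc n) \<omega> - b (h * i / Suc n) \<omega>)) - (\<mu> * (h * j) + \<sigma> * w (h * j) \<omega>))" for j
  have S: "S j n \<in> borel_measurable M" "(\<lambda>n. expectation (\<lambda>\<omega>. min 1 \<bar>S j n \<omega>\<bar>)) \<longlonglongrightarrow> 0" for j n
    unfolding S_def 
    using price_return_sums_uniform_grid(1)[where j = j and n = n, OF w b h]
      price_return_sums_uniform_grid(2)[where j = j, OF w b h] by - assumption+
  have int: "integrable M (\<lambda>\<omega>. min 1 \<bar>S j n \<omega>\<bar>)" for n
    by (rule integrable_const_bound[where B = 1])
       (auto intro!: borel_measurable_min borel_measurable_abs S(1))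
  obtain r where r: "strict_mono r" and lim: "AE \<omega> in M. (\<lambda>n. S (Suc j) (r n) \<omega>) \<longlonglongrightarrow> 0"
    "AE \<omega> in M. (\<lambda>n. min 1 \<bar>S j (r n) \<omega>\<bar>) \<longlonglongrightarrow> 0"
    by (rule AE_common_subseq[of "S (Suc j)" "\<lambda>n \<omega>. min 1 \<bar>S j n \<omega>\<bar>", OF S(1) int _ S(2) S(2)]) auto
  have pos: "AE \<omega> in M. \<forall>t\<ge>0. b t \<omega> > 0"
    using b unfolding price_process_def by blast
  from lim pos show ?thesis
  proof eventually_elim
    case (elim \<omega>)
    have "(\<lambda>n. S j (r n) \<omega>) \<longlonglongrightarrow> 0" by (rule tendsto_zero_of_min_abs) fact
    from tendsto_diff[OF elim(1) this]
    have "(\<lambda>n. S (Suc j) (r n) \<omega> - S j (r n) \<omega>) \<longlonglongrightarrow> 0" by simp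
    moreover have "ln (b (h * Suc j) \<omega>) - ln (b (h * j) \<omega>) - (\<mu> * h + \<sigma> * (w (h * Suc j) \<omega> - w (h * j) \<omega>))
        \<le> S (Suc j) n \<omega> - S j n \<omega>" for n
    proof -
      define s where "s i = h * real i / Suc n" for i :: nat
      \<comment> \<open>The excess of the summed returns over the logarithmic return, which each step can only increase.\<close>
      define G where "G N = (\<Sum>i<N. 1 / b (s i) \<omega> * (b (s (Suc i)) \<omega> - b (s i) \<omega>)) - ln (b (s N) \<omega>)" for N
      have "G N \<le> G (Suc N)" for N
      proof -
        have p: "b (s N) \<omega> > 0" "b (s (Suc N)) \<omega> > 0"
          using elim(3) h by (auto simp: s_def simp del: of_nat_Suc)
        have "ln (b (s (Suc N)) \<omega>) - ln (b (s N) \<omega>) = ln (b (s (Suc N)) \<omega> / b (s N) \<omega>)"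
          using p by (simp add: ln_div)
        also have "\<dots> \<le> b (s (Suc N)) \<omega> / b (s N) \<omega> - 1"
          using p by (intro ln_le_minus_one) simp
        also have "\<dots> = 1 / b (s N) \<omega> * (b (s (Suc N)) \<omega> - b (s N) \<omega>)"
          using p by (simp add: field_simps)
        finally show ?thesis by (simp add: G_def)
      qed
      then have "G (j * Suc n) \<le> G (Suc j * Suc n)" by (rule lift_Suc_mono_le) simp
      moreover have "G (k * Suc n) = S k n \<omega> + \<mu> * (h * k) + \<sigma> * w (h * k) \<omega> - ln (b (h * k) \<omega>)" for k
      proof -
        have sk: "s (k * Suc n) = h * k"
          unfolding s_def of_nat_mult by (simp del: of_nat_Suc)
        have Sk: "S k n \<omega> = (\<Sum>i<k * Suc n. 1 / b (s i) \<omega> * (b (s (Suc i)) \<omega> - b (s i) \<omega>))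
            - (\<mu> * (h * k) + \<sigma> * w (h * k) \<omega>)"
          by (simp only: S_def s_def)
        show ?thesis unfolding G_def sk Sk by linarith
      qed
      moreover have "\<mu> * (h * real (Suc j)) - \<mu> * (h * real j) = \<mu> * h"
        by (simp add: algebra_simps)
      moreover have "\<sigma> * (w (h * Suc j) \<omega> - w (h * j) \<omega>) = \<sigma> * w (h * Suc j) \<omega> - \<sigma> * w (h * j) \<omega>"
        by (rule right_diff_distrib)
      ultimately show ?thesis by smt
    qed
    ultimately have "ln (b (h * Suc j) \<omega>) - ln (b (h * j) \<omega>) - (\<mu> * h + \<sigma> * (w (h * Suc j) \<omega> - w (h * j) \<omega>)) \<le> 0"
      by (intro LIMSEQ_le_const) auto
    then show ?case by simp
  qed
qed

text \<open>All requirements of the pathwise lemma hold almost surely at once: the increment inequalities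
  concern countably many grids, and a single subsequence serves the Ito sums and the quadratic
  variation of \<open>w\<close>.\<close>

lemma price_process_eq_geometric_brownian_motion:
  fixes T \<mu> \<sigma> :: real
  assumes w: "wiener_process M F w" and b: "price_process M F w \<mu> \<sigma> b"
    and \<mu>: "\<mu> > 0" and \<sigma>: "\<sigma> > 0" and T: "T > 0"
  shows "AE \<omega> in M. b T \<omega> = exp ((\<mu> - \<sigma>\<^sup>2 / 2) * T + \<sigma> * w T \<omega>)"
proof -
  have ae: "AE \<omega> in M. w 0 \<omega> = 0" "AE \<omega> in M. continuous_on {0..} (\<lambda>t. w t \<omega>)"
    "AE \<omega> in M. b 0 \<omega> = 1" "AE \<omega> in M. continuous_on {0..} (\<lambda>t. b t \<omega>)"
    "AE \<omega> in M. \<forall>t\<ge>0. b t \<omega> > 0"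
    using w b unfolding wiener_process_def price_process_def by blast+
  have mono: "AE \<omega> in M. \<forall>n i. ln (b (T / Suc n * Suc i) \<omega>) - ln (b (T / Suc n * i) \<omega>)
      \<le> \<mu> * (T / Suc n) + \<sigma> * (w (T / Suc n * Suc i) \<omega> - w (T / Suc n * i) \<omega>)"
    unfolding AE_all_countable
    by (intro allI log_price_increment_le[OF w b]) (use T in simp)
  define S where "S = (\<lambda>n \<omega>. (\<Sum>i<1 * Suc n. 1 / b (T * i / Suc n) \<omega> *
    (b (T * Suc i / Suc n) \<omega> - b (T * i / Suc n) \<omega>)) - (\<mu> * (T * real 1) + \<sigma> * w (T * real 1) \<omega>))"
  define Q where "Q = (\<lambda>n \<omega>. ((\<Sum>i<Suc n. (w (T * Suc i / Suc n) \<omega> - w (T * i / Suc n) \<omega>)\<^sup>2) - T)\<^sup>2)"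
  have S: "S n \<in> borel_measurable M" "(\<lambda>n. expectation (\<lambda>\<omega>. min 1 \<bar>S n \<omega>\<bar>)) \<longlonglongrightarrow> 0" for n
    unfolding S_def 
    using price_return_sums_uniform_grid(1)[where j = 1 and n = n, OF w b T]
      price_return_sums_uniform_grid(2)[where j = 1, OF w b T] by - assumption+
  have Q: "integrable M (Q n)" "(\<lambda>n. expectation (Q n)) \<longlonglongrightarrow> 0" for n
    unfolding Q_def using wiener_quadratic_variation[OF w T] by - assumption+
  obtain r where r: "strict_mono r" and lim: "AE \<omega> in M. (\<lambda>n. S (r n) \<omega>) \<longlonglongrightarrow> 0"
    "AE \<omega> in M. (\<lambda>n. Q (r n) \<omega>) \<longlonglongrightarrow> 0"
    by (rule AE_common_subseq[of S Q, OF S(1) Q(1) _ S(2) Q(2)]) (auto simp: Q_def)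
  from ae mono lim show ?thesis
  proof eventually_elim
    case (elim \<omega>)
    have pos: "b t \<omega> > 0" if "t \<ge> 0" for t using elim(5) that by blast
    have "ln (b T \<omega>) = (\<mu> - \<sigma>\<^sup>2 / 2) * T + \<sigma> * w T \<omega>"
    proof (rule log_price_pathwise[OF T \<mu> \<sigma> _ _ _ _ _ r, of "\<lambda>t. ln (b t \<omega>)" "\<lambda>t. w t \<omega>"])
      show "continuous_on {0..T} (\<lambda>t. ln (b t \<omega>))"
        by (rule continuous_on_ln) 
           (use elim(4) pos in \<open>auto intro: continuous_on_subset simp: less_imp_neq[symmetric]\<close>)
      show "continuous_on {0..T} (\<lambda>t. w t \<omega>)"
        using elim(2) by (rule continuous_on_subset) auto
      show "ln (b 0 \<omega>) = 0" "w 0 \<omega> = 0" using elim(1,3) by simp_all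
      show "ln (b (T * Suc i / Suc n) \<omega>) - ln (b (T * i / Suc n) \<omega>)
          \<le> \<mu> * (T / Suc n) + \<sigma> * (w (T * Suc i / Suc n) \<omega> - w (T * i / Suc n) \<omega>)" for n i
        using elim(6) by (simp only: times_divide_eq_left)
      have eq: "exp (ln (b (T * Suc i / Suc n) \<omega>) - ln (b (T * i / Suc n) \<omega>)) - 1 =
          1 / b (T * i / Suc n) \<omega> * (b (T * Suc i / Suc n) \<omega> - b (T * i / Suc n) \<omega>)" for i n :: nat
      proof -
        have "b (T * Suc i / Suc n) \<omega> > 0" "b (T * i / Suc n) \<omega> > 0"
          using T by (auto intro!: pos simp del: of_nat_Suc)
        then show ?thesis by (simp add: exp_diff diff_divide_distrib)
      qed
      have "(\<lambda>k. S (r k) \<omega> + (\<mu> * T + \<sigma> * w T \<omega>)) \<longlonglongrightarrow> 0 + (\<mu> * T + \<sigma> * w T \<omega>)"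
        by (intro tendsto_add elim(7) tendsto_const)
      then show "(\<lambda>k. \<Sum>i<Suc (r k). exp (ln (b (T * Suc i / Suc (r k)) \<omega>) - ln (b (T * i / Suc (r k)) \<omega>)) - 1)
          \<longlonglongrightarrow> \<mu> * T + \<sigma> * w T \<omega>"
        unfolding eq S_def by simp
      have "(\<lambda>k. (\<Sum>i<Suc (r k). (w (T * Suc i / Suc (r k)) \<omega> - w (T * i / Suc (r k)) \<omega>)\<^sup>2) - T) \<longlonglongrightarrow> 0"
        using elim(8) unfolding Q_def by (subst (asm) power_tendsto_0_iff) simp_all
      then show "(\<lambda>k. \<Sum>i<Suc (r k). (w (T * Suc i / Suc (r k)) \<omega> - w (T * i / Suc (r k)) \<omega>)\<^sup>2) \<longlonglongrightarrow> T"
        by (rule LIM_zero_cancel)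
    qed
    then show ?case using pos[of T] T by (metis exp_ln less_imp_le)
  qed
qed

text \<open>Completing the square: the exponential factor shifts the mean of the Gaussian density by \<open>a * T\<close>
  and rescales it by the asserted constant.\<close>

lemma wiener_exp_moment:
  assumes w: "wiener_process M F w" and T: "T > 0"
  shows "integrable M (\<lambda>\<omega>. exp (a * w T \<omega>))" "expectation (\<lambda>\<omega>. exp (a * w T \<omega>)) = exp (a\<^sup>2 * T / 2)"
proof -
  let ?D = "\<lambda>\<omega>. w T \<omega> - w 0 \<omega>"
  have [measurable]: "w T \<in> borel_measurable M" "w 0 \<in> borel_measurable M"
    using wiener_measurable[OF w] T by auto
  have "distributed M lborel ?D (normal_density 0 (sqrt (T - 0)))"
    using w T unfolding wiener_process_def by blast
  then have d: "distributed M lborel ?D (normal_density 0 (sqrt T))" by simp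
  have w0: "AE \<omega> in M. w 0 \<omega> = 0" using w unfolding wiener_process_def by blast
  have tilt: "normal_density 0 (sqrt T) x * exp (a * x) = exp (a\<^sup>2 * T / 2) * normal_density (a * T) (sqrt T) x" for x
  proof -
    have "- x\<^sup>2 / (2 * T) + a * x = a\<^sup>2 * T / 2 + - (x - a * T)\<^sup>2 / (2 * T)"
      using T by (simp add: field_simps power2_eq_square)
    then show ?thesis
      using T by (simp add: normal_density_def exp_add[symmetric] mult.left_commute)
  qed
  have sT: "sqrt T > 0" using T by simp
  have D: "integrable M (\<lambda>\<omega>. exp (a * ?D \<omega>))" "expectation (\<lambda>\<omega>. exp (a * ?D \<omega>)) = exp (a\<^sup>2 * T / 2)"
    using distributed_integrable[OF d, of "\<lambda>x. exp (a * x)"] distributed_integral[OF d, of "\<lambda>x. exp (a * x)"]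
      integrable_normal_density[OF sT] integral_normal_density[OF sT]
    by (auto simp: tilt)
  have ae: "AE \<omega> in M. exp (a * ?D \<omega>) = exp (a * w T \<omega>)"
    using w0 by eventually_elim simp
  show "integrable M (\<lambda>\<omega>. exp (a * w T \<omega>))"
    by (rule integrable_cong_AE_imp[OF D(1) _ ae]) measurable
  have "expectation (\<lambda>\<omega>. exp (a * ?D \<omega>)) = expectation (\<lambda>\<omega>. exp (a * w T \<omega>))"
    by (rule integral_cong_AE[OF _ _ ae]) measurable
  with D(2) show "expectation (\<lambda>\<omega>. exp (a * w T \<omega>)) = exp (a\<^sup>2 * T / 2)" by simp
qed

lemma expectation_price:
  fixes T \<mu> \<sigma> :: real
  assumes w: "wiener_process M F w" and b: "price_process M F w \<mu> \<sigma> b"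
    and \<mu>: "\<mu> > 0" and \<sigma>: "\<sigma> > 0" and T: "T > 0"
  shows "integrable M (b T)" "expectation (b T) = exp (\<mu> * T)"
proof -
  have [measurable]: "b T \<in> borel_measurable M" "w T \<in> borel_measurable M"
    using price_measurable[OF w b] wiener_measurable[OF w] T by auto
  define Z where "Z = (\<lambda>\<omega>. exp ((\<mu> - \<sigma>\<^sup>2 / 2) * T) * exp (\<sigma> * w T \<omega>))"
  have [measurable]: "Z \<in> borel_measurable M" unfolding Z_def by measurable
  have ae: "AE \<omega> in M. Z \<omega> = b T \<omega>"
    using price_process_eq_geometric_brownian_motion[OF assms]
    by eventually_elim (simp add: Z_def exp_add)
  have "integrable M Z" "expectation Z = exp ((\<mu> - \<sigma>\<^sup>2 / 2) * T) * exp (\<sigma>\<^sup>2 * T / 2)"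
    unfolding Z_def using wiener_exp_moment[OF w T, of \<sigma>] by simp_all
  moreover have "exp ((\<mu> - \<sigma>\<^sup>2 / 2) * T) * exp (\<sigma>\<^sup>2 * T / 2) = exp (\<mu> * T)"
    unfolding exp_add[symmetric] by (simp add: algebra_simps)
  ultimately have Z: "integrable M Z" "expectation Z = exp (\<mu> * T)" by simp_all
  show "integrable M (b T)" by (rule integrable_cong_AE_imp[OF Z(1) _ ae]) measurable
  have "expectation Z = expectation (b T)" by (rule integral_cong_AE[OF _ _ ae]) measurable
  with Z(2) show "expectation (b T) = exp (\<mu> * T)" by simp
qed

end

section \<open>The optimal hedge\<close>

theorem theorem1:
  fixes M :: "'a measure" and F :: "real \<Rightarrow> 'a measure"
    and w b :: "real \<Rightarrow> 'a \<Rightarrow> real"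
    and f :: "real \<Rightarrow> real"
    and \<mu>\<^sub>0 \<sigma>\<^sub>0 \<theta> :: real
  assumes "prob_space M"
    and "wiener_process M F w"
    and "\<mu>\<^sub>0 > 0" and "\<sigma>\<^sub>0 > 0"
    and "price_process M F w \<mu>\<^sub>0 \<sigma>\<^sub>0 b"
    and "inada f"
    and "0 < \<theta>" and "\<theta> < 1"
  shows "(\<exists>!c. integral\<^sup>L M (\<lambda>\<omega>. min (b \<theta> \<omega>) c) = 1) \<and>
    (\<forall>c. integral\<^sup>L M (\<lambda>\<omega>. min (b \<theta> \<omega>) c) = 1 \<longrightarrow>
       (\<exists>u z. optimal M f (b \<theta>) u z \<and> u > 0 \<and> deriv f u = c) \<and>
       (\<forall>u z. optimal M f (b \<theta>) u z \<longrightarrow> objective M f (b \<theta>) u z = threshold_value M f (b \<theta>) c) \<and>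
       (threshold_value M f (b \<theta>) c < \<infinity> \<longrightarrow>
          (\<forall>u z. optimal M f (b \<theta>) u z \<longrightarrow> u > 0 \<and> deriv f u = c)))"
proof -
  interpret prob_space M by fact
  note f = \<open>inada f\<close>
  let ?B = "b \<theta>"
  have int: "integrable M ?B" and E: "expectation ?B = exp (\<mu>\<^sub>0 * \<theta>)"
    using expectation_price[OF assms(2,5,3,4,7)] by auto
  then have E1: "expectation ?B > 1" using assms by simp
  have B: "?B \<in> borel_measurable M" using int by simp
  have B0: "AE \<omega> in M. ?B \<omega> > 0"
    using price_process_eq_geometric_brownian_motion[OF assms(2,5,3,4,7)] by eventually_elim simp
  have "(\<exists>u z. optimal M f ?B u z \<and> u > 0 \<and> deriv f u = c) \<and>
       (\<forall>u z. optimal M f ?B u z \<longrightarrow> objective M f ?B u z = threshold_value M f ?B c) \<and>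
       (threshold_value M f ?B c < \<infinity> \<longrightarrow>
          (\<forall>u z. optimal M f ?B u z \<longrightarrow> u > 0 \<and> deriv f u = c))"
    if Ec: "expectation (\<lambda>\<omega>. min (?B \<omega>) c) = 1" for c
  proof -
    have "1 \<le> expectation (\<lambda>\<omega>. c)"
      unfolding Ec[symmetric] using int by (intro integral_mono) auto
    then have c: "c > 0" by (simp add: prob_space)
    note opt = optimal_threshold_policy[OF f B B0 c int Ec]
    \<comment> \<open>Any two optimal policies have the same value.\<close>
    have val: "objective M f ?B u z = threshold_value M f ?B c" if "optimal M f ?B u z" for u z
      using opt that unfolding optimal_def by (metis antisym)
    have "u = demand f c" if "optimal M f ?B u z" "threshold_value M f ?B c < \<infinity>" for u z
      using optimal_imp_demand[OF f B B0 c int Ec E1 _ val[OF that(1)] that(2)] that(1)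
      by (simp add: optimal_def)
    with opt(1) val demand_pos[OF f c] deriv_demand[OF f c] show ?thesis by metis
  qed
  with ex1_threshold[OF int B0 E1] show ?thesis by blast
qed

end
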